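(* Let $n,m\in\mathbb N$ satisfy $n,m\ge 2$. (1) The positive cone of $C(S^1)^{(n)}\otimes_{\max}C(S^1)^{(m)}$ coincides with the separability cone $(C(S^1)^{(n)})_+\otimes_{\rm sep}(C(S^1)^{(m)})_+$. (2) The positive cone of $C(S^1)^{(2)}\otimes_{\min}C(S^1)^{(m)}$ coincides with the separability cone $(C(S^1)^{(2)})_+\otimes_{\rm sep}(C(S^1)^{(m)})_+$. (3) If $x_0,x_1$ are $m\times m$ Toeplitz matrices for which $\begin{bmatrix} x_0 & x_1^* \\ x_1 & x_0 \end{bmatrix}$ is a positive operator, then for every $n\ge 3$ there exist $m\times m$ Toeplitz matrices $x_2,\dots,x_{n-1}$ such that $$\begin{bmatrix} x_0 & x_1^* & \dots & x_{n-1}^* \\ x_1 & x_0 & \ddots & \vdots \\ \vdots & \ddots & \ddots & x_1^* \\ x_{n-1} & \dots & x_1 & x_0 \end{bmatrix}$$ is a positive operator.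
   Context: $C(S^1)^{(n)}$ is the operator system of all $n\times n$ complex Toeplitz matrices $[\tau_{k-\ell}]_{k,\ell=0}^{n-1}$, as an operator subsystem of $\mathcal M_n(\mathbb C)$ (order unit the identity matrix). "Positive" for matrices/operators means positive semidefinite. For operator systems $\mathcal R,\mathcal T$ with order units $e_{\mathcal R},e_{\mathcal T}$: - $\mathcal R_+\otimes_{\rm sep}\mathcal T_+=\{\sum_{j=1}^k a_j\otimes b_j : k\in\mathbb N,\ a_j\in\mathcal R_+,\ b_j\in\mathcal T_+\}$. - $\mathcal R\otimes_{\min}\mathcal T$: $x\in\mathcal M_p(\mathcal R\otimes\mathcal T)$ is positive iff $(\phi\otimes\psi)^{(p)}(x)\ge 0$ for all $k,q\in\mathbb N$ and all unital completely positive $\phi:\mathcal R\to\mathcal M_k(\mathbb C)$, $\psi:\mathcal T\to\mathcal M_q(\mathbb C)$. (For $\mathcal R\subseteq\mathcal M_n(\mathbb C)$, $\mathcal T\subseteq\mathcal M_m(\mathbb C)$ this is the order inherited from $\mathcal M_n(\mathbb C)\otimes\mathcal M_m(\mathbb C)$.) - $\mathcal R\otimes_{\max}\mathcal T$: $x\in\mathcal R\otimes\mathcal T$ is positive (base level) iff for every $\varepsilon>0$ there are $k,q\in\mathbb N$, $a\in\mathcal M_k(\mathcal R)_+$, $b\in\mathcal M_q(\mathcal T)_+$ and a linear map $\delta:\mathbb C\to\mathbb C^k\otimes\mathbb C^q$ with $\varepsilon(e_{\mathcal R}\otimes e_{\mathcal T})+x=\delta^*(a\otimes b)\delta$. *)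

theory Defs
  imports "Jordan_Normal_Form.Schur_Decomposition"
begin

(* The order on complex is that of Complex_Order, so "0 \<le> z" says that z is real and nonnegative;
   positivity of all z = <A v, v> is positivity of the operator A on C^d (in particular A is
   then Hermitian). *)
definition psd :: "nat \<Rightarrow> complex mat \<Rightarrow> bool" where
  "psd d A \<longleftrightarrow> A \<in> carrier_mat d d \<and> (\<forall>v \<in> carrier_vec d. 0 \<le> (A *\<^sub>v v) \<bullet>c v)"

definition toeplitz :: "nat \<Rightarrow> complex mat set" where
  "toeplitz n = {mat n n (\<lambda>(k, l). \<tau> (int k - int l)) | \<tau> :: int \<Rightarrow> complex. True}"

(* Operator systems are concrete: unital self-adjoint subspaces of M_n(C). *)
definition op_system :: "nat \<Rightarrow> complex mat set \<Rightarrow> bool" where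
  "op_system n R \<longleftrightarrow> R \<subseteq> carrier_mat n n \<and> 1\<^sub>m n \<in> R \<and>
     (\<forall>a \<in> R. \<forall>b \<in> R. a + b \<in> R) \<and> (\<forall>c. \<forall>a \<in> R. c \<cdot>\<^sub>m a \<in> R) \<and> (\<forall>a \<in> R. mat_adjoint a \<in> R)"

(* M_p(M_d(C)) is identified with M_{pd}(C): entry (i, j) of a p x p matrix over M_d(C)
   is the d x d block at position (i, j). *)
definition block :: "nat \<Rightarrow> complex mat \<Rightarrow> nat \<Rightarrow> nat \<Rightarrow> complex mat" where
  "block d A i j = mat d d (\<lambda>(r, s). A $$ (i * d + r, j * d + s))"

definition of_blocks :: "nat \<Rightarrow> nat \<Rightarrow> (nat \<Rightarrow> nat \<Rightarrow> complex mat) \<Rightarrow> complex mat" where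
  "of_blocks p d B = mat (p * d) (p * d) (\<lambda>(g, h). B (g div d) (h div d) $$ (g mod d, h mod d))"

definition pos_cone :: "nat \<Rightarrow> complex mat set \<Rightarrow> complex mat set" where
  "pos_cone n R = {a \<in> R. psd n a}"

definition mat_pos_cone :: "nat \<Rightarrow> nat \<Rightarrow> complex mat set \<Rightarrow> complex mat set" where
  "mat_pos_cone p n R = {A \<in> carrier_mat (p * n) (p * n).
     (\<forall>i < p. \<forall>j < p. block n A i j \<in> R) \<and> psd (p * n) A}"

(* Linearity and positivity only concern the values of \<phi> on R; outside R it is arbitrary. *)
definition ucp :: "nat \<Rightarrow> complex mat set \<Rightarrow> nat \<Rightarrow> (complex mat \<Rightarrow> complex mat) \<Rightarrow> bool" where
  "ucp n R k \<phi> \<longleftrightarrow>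
     (\<forall>a \<in> R. \<phi> a \<in> carrier_mat k k) \<and>
     (\<forall>a \<in> R. \<forall>b \<in> R. \<phi> (a + b) = \<phi> a + \<phi> b) \<and>
     (\<forall>c. \<forall>a \<in> R. \<phi> (c \<cdot>\<^sub>m a) = c \<cdot>\<^sub>m \<phi> a) \<and>
     \<phi> (1\<^sub>m n) = 1\<^sub>m k \<and>
     (\<forall>p \<ge> 1. \<forall>A \<in> mat_pos_cone p n R. psd (p * k) (of_blocks p k (\<lambda>i j. \<phi> (block n A i j))))"

(* Kronecker product, realising M_n(C) \<otimes> M_m(C) as M_{nm}(C) = M_n(M_m(C)). *)
definition kron :: "complex mat \<Rightarrow> complex mat \<Rightarrow> complex mat" where
  "kron A B = mat (dim_row A * dim_row B) (dim_col A * dim_col B)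
     (\<lambda>(g, h). A $$ (g div dim_row B, h div dim_col B) * B $$ (g mod dim_row B, h mod dim_col B))"

definition sum_kron :: "nat \<Rightarrow> nat \<Rightarrow> (nat \<Rightarrow> complex mat) \<Rightarrow> (nat \<Rightarrow> complex mat) \<Rightarrow> complex mat" where
  "sum_kron d l a b = mat d d (\<lambda>(g, h). \<Sum>j < l. kron (a j) (b j) $$ (g, h))"

(* The algebraic tensor product, as a subspace of M_{nm}(C). *)
definition tensor :: "nat \<Rightarrow> complex mat set \<Rightarrow> nat \<Rightarrow> complex mat set \<Rightarrow> complex mat set" where
  "tensor n R m T = {sum_kron (n * m) l a b | l a b. \<forall>j < l. a j \<in> R \<and> b j \<in> T}"

definition sep_cone :: "nat \<Rightarrow> complex mat set \<Rightarrow> nat \<Rightarrow> complex mat set \<Rightarrow> complex mat set" where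
  "sep_cone n R m T = {sum_kron (n * m) l a b | l a b.
     \<forall>j < l. a j \<in> pos_cone n R \<and> b j \<in> pos_cone m T}"

(* The linear map \<phi> \<otimes> \<psi> from R \<otimes> T to M_k(C) \<otimes> M_q(C). The value does not depend on the
   representation of x as a sum of elementary tensors, see tensor_map_sum_kron. *)
definition tensor_map ::
  "nat \<Rightarrow> complex mat set \<Rightarrow> nat \<Rightarrow> (complex mat \<Rightarrow> complex mat) \<Rightarrow>
   nat \<Rightarrow> complex mat set \<Rightarrow> nat \<Rightarrow> (complex mat \<Rightarrow> complex mat) \<Rightarrow> complex mat \<Rightarrow> complex mat" where
  "tensor_map n R k \<phi> m T q \<psi> x =
     (THE y. \<exists>l a b. (\<forall>j < l. a j \<in> R \<and> b j \<in> T) \<and> x = sum_kron (n * m) l a b \<and>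
        y = sum_kron (k * q) l (\<lambda>j. \<phi> (a j)) (\<lambda>j. \<psi> (b j)))"

(* The cone of the operator system itself, i.e. the matrix level p = 1. *)
definition min_cone :: "nat \<Rightarrow> complex mat set \<Rightarrow> nat \<Rightarrow> complex mat set \<Rightarrow> complex mat set" where
  "min_cone n R m T = {x \<in> tensor n R m T.
     \<forall>k \<ge> 1. \<forall>q \<ge> 1. \<forall>\<phi> \<psi>. ucp n R k \<phi> \<longrightarrow> ucp m T q \<psi> \<longrightarrow>
       psd (k * q) (tensor_map n R k \<phi> m T q \<psi> x)}"

(* a \<otimes> b for a in M_k(R) and b in M_q(T), as an element of M_{kq}(R \<otimes> T): the entry indexed by the
   pairs (i, r), (j, s), with i, j < k and r, s < q, is a_{ij} \<otimes> b_{rs}; the pair (i, r) is numbered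
   i q + r. *)
definition mat_tensor :: "nat \<Rightarrow> nat \<Rightarrow> nat \<Rightarrow> nat \<Rightarrow> complex mat \<Rightarrow> complex mat \<Rightarrow> complex mat" where
  "mat_tensor k n q m a b = of_blocks (k * q) (n * m)
     (\<lambda>u v. kron (block n a (u div q) (v div q)) (block m b (u mod q) (v mod q)))"

(* \<delta> : C \<rightarrow> C^k \<otimes> C^q is a column of length kq; on operators over R \<otimes> T it acts as
   \<delta> \<otimes> 1, so that \<delta>^* X \<delta> is the sum of cnj \<delta>_u * \<delta>_v * X_{uv}. *)
definition max_cone :: "nat \<Rightarrow> complex mat set \<Rightarrow> nat \<Rightarrow> complex mat set \<Rightarrow> complex mat set" where
  "max_cone n R m T = {x \<in> tensor n R m T.
     \<forall>\<epsilon> > (0::real). \<exists>k \<ge> 1. \<exists>q \<ge> 1.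
       \<exists>a \<in> mat_pos_cone k n R. \<exists>b \<in> mat_pos_cone q m T. \<exists>\<delta> \<in> carrier_mat (k * q) 1.
         complex_of_real \<epsilon> \<cdot>\<^sub>m kron (1\<^sub>m n) (1\<^sub>m m) + x =
           mat_adjoint (kron \<delta> (1\<^sub>m (n * m))) * mat_tensor k n q m a b * kron \<delta> (1\<^sub>m (n * m))}"

definition block_toeplitz :: "nat \<Rightarrow> nat \<Rightarrow> (nat \<Rightarrow> complex mat) \<Rightarrow> complex mat" where
  "block_toeplitz n m x =
     of_blocks n m (\<lambda>i j. if j \<le> i then x (i - j) else mat_adjoint (x (j - i)))"


lemma mat_adjoint_index:
  "i < dim_col A \<Longrightarrow> j < dim_row A \<Longrightarrow> mat_adjoint (A :: complex mat) $$ (i, j) = cnj (A $$ (j, i))"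
  by (simp add: mat_adjoint_def mat_of_rows_def)

lemma mat_adjoint_dim [simp]:
  "dim_row (mat_adjoint (A :: complex mat)) = dim_col A" "dim_col (mat_adjoint A) = dim_row A"
  by (simp_all add: mat_adjoint_def)

lemma toeplitzI: "a = mat n n (\<lambda>(k, l). \<tau> (int k - int l)) \<Longrightarrow> a \<in> toeplitz n"
  unfolding toeplitz_def by blast

lemma op_system_toeplitz: "op_system n (toeplitz n)"
  unfolding op_system_def
proof (intro conjI ballI allI)
  show "toeplitz n \<subseteq> carrier_mat n n" by (auto simp: toeplitz_def)
  have "1\<^sub>m n = mat n n (\<lambda>(k, l). (\<lambda>d. if d = 0 then (1::complex) else 0) (int k - int l))"
    by (rule eq_matI) auto
  thus "1\<^sub>m n \<in> toeplitz n" by (rule toeplitzI)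
next
  fix a b assume "a \<in> toeplitz n" "b \<in> toeplitz n"
  then obtain s t where "a = mat n n (\<lambda>(k, l). s (int k - int l))"
    "b = mat n n (\<lambda>(k, l). t (int k - int l))" unfolding toeplitz_def by auto
  hence "a + b = mat n n (\<lambda>(k, l). (\<lambda>d. s d + t d) (int k - int l))"
    by (intro eq_matI) auto
  thus "a + b \<in> toeplitz n" by (rule toeplitzI)
next
  fix c a assume "a \<in> toeplitz n"
  then obtain s where "a = mat n n (\<lambda>(k, l). s (int k - int l))" unfolding toeplitz_def by auto
  hence "c \<cdot>\<^sub>m a = mat n n (\<lambda>(k, l). (\<lambda>d. c * s d) (int k - int l))"
    by (intro eq_matI) auto
  thus "c \<cdot>\<^sub>m a \<in> toeplitz n" by (rule toeplitzI)
next
  fix a assume "a \<in> toeplitz n"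
  then obtain s where "a = mat n n (\<lambda>(k, l). s (int k - int l))" unfolding toeplitz_def by auto
  hence "mat_adjoint a = mat n n (\<lambda>(k, l). (\<lambda>d. cnj (s (- d))) (int k - int l))"
    by (intro eq_matI) (auto simp: mat_adjoint_index)
  thus "mat_adjoint a \<in> toeplitz n" by (rule toeplitzI)
qed

lemma op_system_lincomb:
  fixes l :: nat
  assumes R: "op_system n R" and \<phi>: "ucp n R k \<phi>" and a: "\<forall>j < l. a j \<in> R"
  shows "mat n n (\<lambda>rs. \<Sum>j<l. c j * a j $$ rs) \<in> R \<and>
    \<phi> (mat n n (\<lambda>rs. \<Sum>j<l. c j * a j $$ rs)) = mat k k (\<lambda>uv. \<Sum>j<l. c j * \<phi> (a j) $$ uv)"
  using a
proof (induction l)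
  case 0
  have I: "1\<^sub>m n \<in> R" using R unfolding op_system_def by auto
  have z: "mat n n (\<lambda>rs. 0) = 0 \<cdot>\<^sub>m (1\<^sub>m n :: complex mat)" by (rule eq_matI) auto
  have "0 \<cdot>\<^sub>m (1\<^sub>m n) \<in> R" using R I unfolding op_system_def by auto
  moreover have "\<phi> (0 \<cdot>\<^sub>m (1\<^sub>m n)) = 0 \<cdot>\<^sub>m 1\<^sub>m k" using \<phi> I unfolding ucp_def by auto
  moreover have "0 \<cdot>\<^sub>m 1\<^sub>m k = mat k k (\<lambda>uv. (0::complex))" by (rule eq_matI) auto
  ultimately show ?case by (simp add: z)
next
  case (Suc l)
  let ?A = "mat n n (\<lambda>rs. \<Sum>j<l. c j * a j $$ rs)"
  have IH: "?A \<in> R" "\<phi> ?A = mat k k (\<lambda>uv. \<Sum>j<l. c j * \<phi> (a j) $$ uv)" using Suc by auto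
  have al: "a l \<in> R" "c l \<cdot>\<^sub>m a l \<in> R" using Suc.prems R unfolding op_system_def by auto
  have cl: "a l \<in> carrier_mat n n" "\<phi> (a l) \<in> carrier_mat k k"
    using al R \<phi> unfolding op_system_def ucp_def by auto
  have e: "mat n n (\<lambda>rs. \<Sum>j<Suc l. c j * a j $$ rs) = ?A + c l \<cdot>\<^sub>m a l"
    using cl by (intro eq_matI) auto
  have "?A + c l \<cdot>\<^sub>m a l \<in> R" using IH al R unfolding op_system_def by auto
  moreover have "\<phi> (?A + c l \<cdot>\<^sub>m a l) = \<phi> ?A + c l \<cdot>\<^sub>m \<phi> (a l)"
    using IH al \<phi> unfolding ucp_def by auto
  moreover have "\<dots> = mat k k (\<lambda>uv. \<Sum>j<Suc l. c j * \<phi> (a j) $$ uv)"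
    unfolding IH(2) using cl by (intro eq_matI) auto
  ultimately show ?case unfolding e by simp
qed

lemma sum_kron_index:
  assumes "\<forall>j < l. a j \<in> carrier_mat n n \<and> b j \<in> carrier_mat m m"
    and "i < n" "i' < n" "r < m" "r' < m"
  shows "sum_kron (n * m) l a b $$ (i * m + r, i' * m + r') =
    (\<Sum>j<l. a j $$ (i, i') * b j $$ (r, r'))"
proof -
  have lt: "i * m + r < n * m" if "i < n" "r < m" for i r
  proof -
    have "i * m + r < (i + 1) * m" using that by simp
    also have "\<dots> \<le> n * m" using that by (intro mult_le_mono1) simp
    finally show ?thesis .
  qed
  have "kron (a j) (b j) $$ (i * m + r, i' * m + r') = a j $$ (i, i') * b j $$ (r, r')"
    if "j < l" for j
  proof -
    have "dim_row (a j) = n" "dim_col (a j) = n" "dim_row (b j) = m" "dim_col (b j) = m"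
      using assms(1) that by auto
    thus ?thesis using assms lt by (simp add: kron_def)
  qed
  thus ?thesis using lt assms by (simp add: sum_kron_def)
qed

lemma tensor_map_sum_kron:
  assumes R: "op_system n R" and T: "op_system m T"
    and \<phi>: "ucp n R k \<phi>" and \<psi>: "ucp m T q \<psi>" and ab: "\<forall>j < l. a j \<in> R \<and> b j \<in> T"
  shows "tensor_map n R k \<phi> m T q \<psi> (sum_kron (n * m) l a b) =
    sum_kron (k * q) l (\<lambda>j. \<phi> (a j)) (\<lambda>j. \<psi> (b j))"
proof -
  define x where "x = sum_kron (n * m) l a b"
  define F where "F = (\<lambda>r s. \<phi> (mat n n (\<lambda>(i, j). x $$ (i * m + r, j * m + s))))"
  define G where "G = (\<lambda>u v. \<psi> (mat m m (\<lambda>(r, s). F r s $$ (u, v))))"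
  have main: "sum_kron (k * q) l (\<lambda>j. \<phi> (a j)) (\<lambda>j. \<psi> (b j)) =
      mat (k * q) (k * q) (\<lambda>(g, h). G (g div q) (h div q) $$ (g mod q, h mod q))"
    if ab: "\<forall>j < l. a j \<in> R \<and> b j \<in> T" and x: "x = sum_kron (n * m) l a b" for l a b
  proof (rule eq_matI, simp_all add: sum_kron_def)
    have car: "\<forall>j < l. a j \<in> carrier_mat n n \<and> b j \<in> carrier_mat m m"
      using ab R T unfolding op_system_def by auto
    have pcar: "\<phi> (a j) \<in> carrier_mat k k" "\<psi> (b j) \<in> carrier_mat q q" if "j < l" for j
      using ab \<phi> \<psi> that unfolding ucp_def by auto
    have F: "F r s = mat k k (\<lambda>uv. \<Sum>j<l. b j $$ (r, s) * \<phi> (a j) $$ uv)"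
      if rs: "r < m" "s < m" for r s
    proof -
      have "mat n n (\<lambda>(i, j). x $$ (i * m + r, j * m + s)) =
          mat n n (\<lambda>ij. \<Sum>j<l. b j $$ (r, s) * a j $$ ij)"
        using rs by (intro eq_matI) (simp_all add: x sum_kron_index[OF car], simp only: mult.commute)
      thus ?thesis unfolding F_def using op_system_lincomb[OF R \<phi>, of l a] ab by simp
    qed
    have G: "G u v = mat q q (\<lambda>rs. \<Sum>j<l. \<phi> (a j) $$ (u, v) * \<psi> (b j) $$ rs)"
      if uv: "u < k" "v < k" for u v
    proof -
      have "mat m m (\<lambda>(r, s). F r s $$ (u, v)) =
          mat m m (\<lambda>rs. \<Sum>j<l. \<phi> (a j) $$ (u, v) * b j $$ rs)"
        using uv by (intro eq_matI) (simp_all add: F, simp only: mult.commute)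
      thus ?thesis unfolding G_def using op_system_lincomb[OF T \<psi>, of l b] ab by simp
    qed
    fix g h assume gh: "g < k * q" "h < k * q"
    hence q: "q > 0" by (cases q) auto
    have d: "g div q < k" "h div q < k" using gh by (auto simp: less_mult_imp_div_less)
    have "kron (\<phi> (a j)) (\<psi> (b j)) $$ (g, h) =
        \<phi> (a j) $$ (g div q, h div q) * \<psi> (b j) $$ (g mod q, h mod q)" if "j < l" for j
    proof -
      have "dim_row (\<phi> (a j)) = k" "dim_col (\<phi> (a j)) = k"
        "dim_row (\<psi> (b j)) = q" "dim_col (\<psi> (b j)) = q" using pcar[OF that] by auto
      thus ?thesis using gh by (simp add: kron_def)
    qed
    thus "(\<Sum>j<l. kron (\<phi> (a j)) (\<psi> (b j)) $$ (g, h)) =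
        G (g div q) (h div q) $$ (g mod q, h mod q)"
      using G[OF d] q by simp
  qed
  show ?thesis
    unfolding tensor_map_def x_def[symmetric]
  proof (rule the_equality)
    show "\<exists>l' a' b'. (\<forall>j < l'. a' j \<in> R \<and> b' j \<in> T) \<and> x = sum_kron (n * m) l' a' b' \<and>
        sum_kron (k * q) l (\<lambda>j. \<phi> (a j)) (\<lambda>j. \<psi> (b j)) =
        sum_kron (k * q) l' (\<lambda>j. \<phi> (a' j)) (\<lambda>j. \<psi> (b' j))"
      using ab x_def by blast
  next
    fix y assume "\<exists>l a b. (\<forall>j < l. a j \<in> R \<and> b j \<in> T) \<and> x = sum_kron (n * m) l a b \<and>
        y = sum_kron (k * q) l (\<lambda>j. \<phi> (a j)) (\<lambda>j. \<psi> (b j))"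
    then obtain l' a' b' where *: "\<forall>j < l'. a' j \<in> R \<and> b' j \<in> T" "x = sum_kron (n * m) l' a' b'"
      "y = sum_kron (k * q) l' (\<lambda>j. \<phi> (a' j)) (\<lambda>j. \<psi> (b' j))" by blast
    show "y = sum_kron (k * q) l (\<lambda>j. \<phi> (a j)) (\<lambda>j. \<psi> (b j))"
      unfolding *(3) main[OF *(1,2)] main[OF ab x_def] ..
  qed
qed

end

theory Submission
  imports Defs
begin

text \<open>
  The key fact is a finite form of Gurvits' theorem: a positive \<open>p \<times> p\<close> matrix over the Toeplitz
  matrices of size \<open>n\<close> is a sum of matrices \<open>g g\<^sup>* \<otimes> t t\<^sup>*\<close> with \<open>t = (z\<^sup>i)\<close> for \<open>i < n\<close> and
  \<open>|z| = 1\<close>. It follows from the spectral theorem, because the shift of the second index is a partial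
  isometry for the semi-inner product given by the matrix, and it extends to an isometry of the whole
  finite-dimensional space.

  Applied to both factors of \<open>\<delta>\<^sup>*(a \<otimes> b)\<delta>\<close>, this exhibits \<open>\<epsilon> 1 + x\<close> as a matrix of
  trigonometric moments of a finitely supported positive measure on the torus; Caratheodory's theorem
  bounds the number of atoms independently of \<open>\<epsilon>\<close>, so a compactness argument gives the same for \<open>x\<close>.
  For a positive element of the minimal tensor product with \<open>n = 2\<close>, averaging the coefficients
  \<open>g g\<^sup>*\<close> with their flips turns them into Toeplitz matrices. The moments of the resulting measure
  of higher order in the first variable are the required extension.
\<close>

subsection \<open>Isometries of semi-inner product spaces\<close>

text \<open>Gaussian elimination, one coordinate per induction step: a member with nonzero last
  coordinate serves as pivot and clears that coordinate in the others. Stated for families, so that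
  repeated vectors count separately, and over any field, since both complex and real relations occur
  below.\<close>

lemma linear_dependence:
  fixes f :: "'l \<Rightarrow> nat \<Rightarrow> 'a::field"
  assumes "finite S" "card S > N"
  shows "\<exists>\<alpha>. (\<exists>l\<in>S. \<alpha> l \<noteq> 0) \<and> (\<forall>i<N. (\<Sum>l\<in>S. \<alpha> l * f l i) = 0)"
  using assms
proof (induction N arbitrary: S f)
  case 0
  then obtain l where "l \<in> S" by fastforce
  thus ?case by (intro exI[of _ "\<lambda>_. 1"]) auto
next
  case (Suc N)
  show ?case
  proof (cases "\<forall>l\<in>S. f l N = 0")
    case True
    obtain \<alpha> where \<alpha>: "\<exists>l\<in>S. \<alpha> l \<noteq> 0" "\<forall>i<N. (\<Sum>l\<in>S. \<alpha> l * f l i) = 0"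
      using Suc.IH[of S f] Suc.prems by auto
    have "(\<Sum>l\<in>S. \<alpha> l * f l N) = 0" using True by simp
    thus ?thesis using \<alpha> by (intro exI[of _ \<alpha>]) (auto simp: less_Suc_eq)
  next
    case False
    then obtain l0 where l0: "l0 \<in> S" "f l0 N \<noteq> 0" by blast
    let ?S = "S - {l0}"
    have "finite ?S" "card ?S > N" using Suc.prems l0 by auto
    from Suc.IH[OF this, of "\<lambda>l i. f l i - f l N / f l0 N * f l0 i"]
    obtain \<alpha> where \<alpha>: "\<exists>l\<in>?S. \<alpha> l \<noteq> 0"
      "\<forall>i<N. (\<Sum>l\<in>?S. \<alpha> l * (f l i - f l N / f l0 N * f l0 i)) = 0" by blast
    \<comment> \<open>The pivot coefficient is the one that makes coordinate \<open>N\<close> of the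
      combination vanish.\<close>
    define \<beta> where "\<beta> = \<alpha>(l0 := - (\<Sum>l\<in>?S. \<alpha> l * f l N) / f l0 N)"
    have \<beta>: "(\<Sum>l\<in>S. \<beta> l * f l i) = (\<Sum>l\<in>?S. \<alpha> l * (f l i - f l N / f l0 N * f l0 i))" for i
    proof -
      have "(\<Sum>l\<in>S. \<beta> l * f l i) = \<beta> l0 * f l0 i + (\<Sum>l\<in>?S. \<beta> l * f l i)"
        using Suc.prems l0 by (simp add: sum.remove)
      also have "(\<Sum>l\<in>?S. \<beta> l * f l i) = (\<Sum>l\<in>?S. \<alpha> l * f l i)"
        by (rule sum.cong) (auto simp: \<beta>_def)
      also have "\<beta> l0 * f l0 i = - (\<Sum>l\<in>?S. \<alpha> l * (f l N / f l0 N * f l0 i))"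
        by (simp add: \<beta>_def sum_distrib_left sum_distrib_right sum_divide_distrib sum_negf ac_simps)
      finally show ?thesis by (simp add: right_diff_distrib sum_subtractf)
    qed
    have "(\<Sum>l\<in>S. \<beta> l * f l i) = 0" if "i < Suc N" for i
      using \<alpha>(2) that l0 by (cases "i = N") (auto simp: \<beta>)
    moreover have "\<exists>l\<in>S. \<beta> l \<noteq> 0" using \<alpha>(1) by (auto simp: \<beta>_def)
    ultimately show ?thesis by blast
  qed
qed

text \<open>The form may be degenerate, so vectors are compared only modulo null vectors, through
  equations \<open>F x w = F y w\<close> for all \<open>w\<close>. By \<open>supp\<close> the form
  sees only the first \<open>N\<close> coordinates; this replaces finite dimensionality.\<close>

locale semi_inner =
  fixes F :: "(nat \<Rightarrow> complex) \<Rightarrow> (nat \<Rightarrow> complex) \<Rightarrow> complex" and N :: nat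
  assumes lin: "F (\<lambda>i. c * x i + y i) w = c * F x w + F y w"
    and herm: "F y x = cnj (F x y)"
    and pos: "0 \<le> Re (F x x)"
    and supp: "(\<And>i. i < N \<Longrightarrow> x i = 0) \<Longrightarrow> F x w = 0"
begin

lemma lin_right: "F w (\<lambda>i. c * x i + y i) = cnj c * F w x + F w y"
  by (subst herm) (simp add: lin herm[of x w] herm[of y w])

lemma F_zero: "F (\<lambda>i. 0) w = 0"
  by (rule supp) simp

lemma F_scale: "F (\<lambda>i. c * x i) w = c * F x w"
  using lin[of c x "\<lambda>i. 0" w] by (simp add: F_zero)

lemma F_scale_right: "F w (\<lambda>i. c * x i) = cnj c * F w x"
  by (subst herm) (simp add: F_scale herm[of x w])

lemma F_sum: "finite S \<Longrightarrow> F (\<lambda>i. \<Sum>l\<in>S. c l * x l i) w = (\<Sum>l\<in>S. c l * F (x l) w)"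
  by (induction S rule: finite_induct) (simp_all add: F_zero lin)

lemma F_self: "F x x = complex_of_real (Re (F x x))"
  using herm[of x x] by (metis Reals_cnj_iff of_real_Re)

text \<open>The degenerate case of Cauchy-Schwarz. If \<open>v\<close> is null, the norm of
  \<open>t * v + w\<close> is affine in \<open>t\<close>, and a suitable \<open>t\<close> in the
  direction of \<open>cnj (F v w)\<close> would make it negative.\<close>

lemma null:
  assumes "F v v = 0"
  shows "F v w = 0"
proof (rule ccontr)
  assume "F v w \<noteq> 0"
  define a where "a = (cmod (F v w))\<^sup>2"
  have a: "a > 0" using \<open>F v w \<noteq> 0\<close> by (simp add: a_def)
  \<comment> \<open>With this \<open>s\<close> the norm below becomes
    \<open>- Re (F w w) - 2\<close>.\<close>
  define s where "s = - (Re (F w w) + 1) / a"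
  define t where "t = of_real s * cnj (F v w)"
  have "F (\<lambda>i. t * v i + w i) (\<lambda>i. t * v i + w i) = t * F v w + cnj (t * F v w) + F w w"
    by (simp add: lin lin_right assms herm[of w v])
  also have "t * F v w = of_real (s * a)"
    by (simp add: t_def a_def mult.assoc) (metis complex_norm_square mult.commute of_real_power)
  finally have "Re (F (\<lambda>i. t * v i + w i) (\<lambda>i. t * v i + w i)) = 2 * (s * a) + Re (F w w)"
    by simp
  moreover have "s * a = - (Re (F w w) + 1)" using a by (simp add: s_def)
  ultimately show False using pos[of "\<lambda>i. t * v i + w i"] pos[of w] by simp
qed

definition isometry :: "((nat \<Rightarrow> complex) \<Rightarrow> nat \<Rightarrow> complex) \<Rightarrow> bool" where
  "isometry U \<longleftrightarrow> (\<forall>c x y. U (\<lambda>i. c * x i + y i) = (\<lambda>i. c * U x i + U y i)) \<and>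
    (\<forall>x y. F (U x) (U y) = F x y)"

text \<open>The isometry is a product of complex Householder reflections, each of which fixes the images
  already obtained.\<close>
lemma isometry_extension:
  fixes M :: nat
  assumes "\<And>k l. k < M \<Longrightarrow> l < M \<Longrightarrow> F (x k) (x l) = F (y k) (y l)"
  shows "\<exists>U. isometry U \<and> (\<forall>k<M. \<forall>w. F (U (x k)) w = F (y k) w)"
  using assms
proof (induction M)
  case 0
  have "isometry id" by (simp add: isometry_def)
  thus ?case by blast
next
  case (Suc M)
  then obtain U where U: "isometry U" "\<And>k w. k < M \<Longrightarrow> F (U (x k)) w = F (y k) w"
    by (metis less_Suc_eq)
  define x' where "x' = U (x M)"
  define d where "d = (\<lambda>i. (-1) * y M i + x' i)"
  have Fd: "F d w = F x' w - F (y M) w" for w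
    using lin[of "-1" "y M" x' w] by (simp add: d_def)
  have Fd': "F w d = F w x' - F w (y M)" for w
    using lin_right[of w "-1" "y M" x'] by (simp add: d_def)
  have right: "F w (U (x k)) = F w (y k)" if "k < M" for w k
    using U(2)[OF that, of w] herm by metis
  \<comment> \<open>\<open>U\<close> already sends each earlier \<open>x k\<close> to
    \<open>y k\<close> modulo null vectors, so \<open>x'\<close> and \<open>y M\<close> have the
    same inner products with all earlier \<open>y k\<close>; hence their difference \<open>d\<close>
    is orthogonal to these.\<close>
  have x'y: "F x' (y k) = F (y M) (y k)" if "k < M" for k
  proof -
    have "F x' (y k) = F (U (x M)) (U (x k))" by (simp add: right[OF that] x'_def)
    also have "\<dots> = F (y M) (y k)" using U(1) Suc.prems[of M k] that by (simp add: isometry_def)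
    finally show ?thesis .
  qed
  have x'x': "F x' x' = F (y M) (y M)"
    using U(1) Suc.prems[of M M] by (simp add: isometry_def x'_def)
  show ?case
  proof (cases "F d d = 0")
    case True
    have "F x' w = F (y M) w" for w
      using null[OF True, of w] by (simp add: Fd)
    thus ?thesis using U by (intro exI[of _ U]) (auto simp: less_Suc_eq x'_def)
  next
    case False
    define g where "g = F x' d"
    have dd: "F d d = g + cnj g"
      by (simp add: g_def Fd Fd' x'x' herm[of "y M" x'] flip: herm[of "y M" "y M"])
    have g: "g \<noteq> 0" using False dd by auto
    \<comment> \<open>The reflection along \<open>d\<close> with factor \<open>1 / g\<close> instead
      of \<open>2 / F d d\<close>: it sends \<open>x'\<close> to \<open>x' - d = y M\<close>. It is
      isometric because \<open>1 / g + 1 / cnj g = F d d / (g * cnj g)\<close>, which is the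
      identity \<open>dd\<close>.\<close>
    define W where "W = (\<lambda>v i. (- F v d / g) * d i + v i)"
    have W: "isometry W"
      unfolding isometry_def
    proof (intro conjI allI)
      fix c and v w :: "nat \<Rightarrow> complex"
      show "W (\<lambda>i. c * v i + w i) = (\<lambda>i. c * W v i + W w i)"
        unfolding W_def lin using g by (intro ext) (simp add: field_simps)
      have "F (W v) (W w) = F v w - F v d * cnj (F w d) / g - F v d * cnj (F w d) / cnj g
          + F v d * cnj (F w d) / (g * cnj g) * F d d"
        unfolding W_def lin lin_right herm[of d w] using g by (simp add: field_simps)
      also have "\<dots> = F v w" unfolding dd using g by (simp add: field_simps)
      finally show "F (W v) (W w) = F v w" .
    qed
    have "F d (y k) = 0" if "k < M" for k using x'y[OF that] by (simp add: Fd)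
    hence yd: "F (y k) d = 0" if "k < M" for k using that herm by (metis complex_cnj_zero)
    have "F (W (U (x k))) w = F (y k) w" if "k < Suc M" for k w
    proof (cases "k = M")
      case True
      thus ?thesis using g by (simp add: W_def x'_def[symmetric] g_def[symmetric])
        (simp add: d_def)
    next
      case False
      thus ?thesis using that U(2)[of k] yd[of k] by (simp add: W_def lin)
    qed
    moreover have "isometry (W \<circ> U)" using W U(1) by (simp add: isometry_def)
    ultimately show ?thesis by (intro exI[of _ "W \<circ> U"] conjI allI impI) (assumption, simp)
  qed
qed


section \<open>Spectral theory of an isometry\<close>

lemma isometry_lin: "isometry U \<Longrightarrow> U (\<lambda>i. c * x i + y i) = (\<lambda>i. c * U x i + U y i)"
  and isometry_F: "isometry U \<Longrightarrow> F (U x) (U y) = F x y"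
  by (simp_all add: isometry_def)

lemma isometry_sum:
  assumes "isometry U" "finite S"
  shows "U (\<lambda>i. \<Sum>l\<in>S. c l * x l i) = (\<lambda>i. \<Sum>l\<in>S. c l * U (x l) i)"
  using assms(2)
proof (induction S rule: finite_induct)
  case empty
  \<comment> \<open>For zero vectors and \<open>c = -1\<close>, linearity reads
    \<open>U 0 = - U 0 + U 0\<close>.\<close>
  show ?case using isometry_lin[OF assms(1), of "-1" "\<lambda>i. 0" "\<lambda>i. 0"] by (simp add: fun_eq_iff)
next
  case (insert a S)
  thus ?case using isometry_lin[OF assms(1), of "c a" "x a" "\<lambda>i. \<Sum>l\<in>S. c l * x l i"] by simp
qed

text \<open>Take a polynomial \<open>p\<close> of minimal degree that annihilates \<open>h\<close>, and split off a linear
  factor \<open>p = (X - z) q\<close>; then \<open>q(U) h\<close> is an eigenvector in the cyclic subspace of \<open>h\<close>.\<close>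
lemma eigenvector_in_cyclic_subspace:
  assumes U: "isometry U" and h: "F h h \<noteq> 0"
  obtains g a z and K :: nat where
    "g = (\<lambda>t. \<Sum>i<K. a i * (U ^^ i) h t)" "F g g \<noteq> 0" "\<And>w. F (U g) w = z * F g w"
proof -
  \<comment> \<open>\<open>E p\<close> is \<open>p(U) h\<close>. The two facts that follow allow any
    longer range of summation, so that polynomials of different degrees can be compared term by
    term.\<close>
  define E where "E = (\<lambda>p t. \<Sum>i<Suc (degree p). coeff p i * (U ^^ i) h t)"
  have FE: "F (E p) w = (\<Sum>i<K. coeff p i * F ((U ^^ i) h) w)" if "degree p < K" for p K w
  proof -
    have "F (E p) w = (\<Sum>i<Suc (degree p). coeff p i * F ((U ^^ i) h) w)"
      unfolding E_def by (rule F_sum) simp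
    also have "\<dots> = (\<Sum>i<K. coeff p i * F ((U ^^ i) h) w)"
      by (rule sum.mono_neutral_left) (use that in \<open>auto intro: coeff_eq_0\<close>)
    finally show ?thesis .
  qed
  have FUE: "F (U (E p)) w = (\<Sum>i<K. coeff p i * F ((U ^^ Suc i) h) w)" if "degree p < K" for p K w
  proof -
    have "F (U (E p)) w = (\<Sum>i<Suc (degree p). coeff p i * F (U ((U ^^ i) h)) w)"
      unfolding E_def isometry_sum[OF U finite_lessThan] by (rule F_sum) simp
    also have "\<dots> = (\<Sum>i<K. coeff p i * F ((U ^^ Suc i) h) w)"
      by (rule sum.mono_neutral_cong_left) (use that in \<open>auto intro: coeff_eq_0\<close>)
    finally show ?thesis .
  qed
  \<comment> \<open>Annihilation is meant modulo null vectors. Such a polynomial exists because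
    \<open>N + 1\<close> iterates of \<open>h\<close> are dependent on the first \<open>N\<close>
    coordinates.\<close>
  define P where "P = (\<lambda>p. p \<noteq> 0 \<and> (\<forall>w. F (E p) w = 0))"
  have "\<exists>p. P p"
  proof -
    obtain \<alpha> where \<alpha>: "\<exists>l\<in>{..<Suc N}. \<alpha> l \<noteq> 0"
        "\<forall>t<N. (\<Sum>l\<in>{..<Suc N}. \<alpha> l * (U ^^ l) h t) = 0"
      using linear_dependence[of "{..<Suc N}" N "\<lambda>l. (U ^^ l) h"] by auto
    define p where "p = (\<Sum>l<Suc N. monom (\<alpha> l) l)"
    have c: "coeff p i = (if i < Suc N then \<alpha> i else 0)" for i
      by (simp add: p_def coeff_sum coeff_monom del: sum.lessThan_Suc)
    have "p \<noteq> 0" using \<alpha>(1) c by (metis coeff_0 lessThan_iff)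
    moreover have "F (E p) w = 0" for w
    proof -
      have "degree p < Suc N" by (rule le_imp_less_Suc, rule degree_le) (simp add: c)
      hence "F (E p) w = (\<Sum>i<Suc N. \<alpha> i * F ((U ^^ i) h) w)"
        by (simp add: FE c del: sum.lessThan_Suc)
      also have "\<dots> = F (\<lambda>t. \<Sum>i<Suc N. \<alpha> i * (U ^^ i) h t) w"
        by (rule F_sum[symmetric]) simp
      also have "\<dots> = 0" by (rule supp) (use \<alpha>(2) in simp)
      finally show ?thesis .
    qed
    ultimately show ?thesis by (auto simp: P_def)
  qed
  then obtain p where p: "P p" and min: "\<And>q. P q \<Longrightarrow> degree p \<le> degree q"
    using ex_has_least_nat[of P _ degree] by metis
  have "degree p \<noteq> 0"
  proof
    assume "degree p = 0"
    hence "F (E p) h = coeff p 0 * F h h" and "coeff p 0 \<noteq> 0"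
      using p by (auto simp: FE[of p 1] P_def leading_coeff_0_iff[symmetric] simp del: leading_coeff_0_iff)
    thus False using p h by (auto simp: P_def)
  qed
  hence "\<not> constant (poly p)" by (simp add: constant_degree)
  then obtain z where "poly p z = 0" using fundamental_theorem_of_algebra by blast
  then obtain q where q: "p = [:-z, 1:] * q" by (auto simp: poly_eq_0_iff_dvd)
  have q0: "q \<noteq> 0" using q p by (auto simp: P_def)
  have deg: "degree p = Suc (degree q)" using q0 unfolding q by (subst degree_mult_eq) auto
  define g where "g = E q"
  \<comment> \<open>This is \<open>p = X * q - z * q\<close> evaluated at \<open>U\<close> and
    \<open>h\<close>; \<open>pCons 0 q\<close> is \<open>X * q\<close>.\<close>
  have "F (U g) w - z * F g w = F (E p) w" for w
  proof -
    define K where "K = Suc (degree q)"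
    have "coeff q K = 0" by (simp add: K_def coeff_eq_0)
    have "F (E p) w = (\<Sum>i<Suc K. coeff p i * F ((U ^^ i) h) w)"
      by (rule FE) (simp add: K_def deg)
    also have "\<dots> = (\<Sum>i<Suc K. coeff (pCons 0 q) i * F ((U ^^ i) h) w)
        - z * (\<Sum>i<Suc K. coeff q i * F ((U ^^ i) h) w)"
      by (simp add: q sum_distrib_left flip: sum_subtractf del: sum.lessThan_Suc)
        (simp add: algebra_simps)
    also have "(\<Sum>i<Suc K. coeff (pCons 0 q) i * F ((U ^^ i) h) w) = F (U g) w"
      unfolding g_def by (subst FUE[of q K]) (simp_all add: K_def sum.lessThan_Suc_shift del: sum.lessThan_Suc)
    also have "(\<Sum>i<Suc K. coeff q i * F ((U ^^ i) h) w) = F g w"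
      unfolding g_def by (rule FE[symmetric]) (simp add: K_def)
    finally show ?thesis by simp
  qed
  hence "F (U g) w = z * F g w" for w using p by (simp add: P_def)
  \<comment> \<open>Minimality of the degree of \<open>p\<close> is what keeps the eigenvector from
    being null.\<close>
  moreover have "\<not> P q" using min[of q] deg by auto
  hence "F g g \<noteq> 0" using null[of g] q0 unfolding P_def g_def by blast
  moreover have "g = (\<lambda>t. \<Sum>i<Suc (degree q). coeff q i * (U ^^ i) h t)" by (simp only: g_def E_def)
  ultimately show ?thesis using that by blast
qed

lemma eigenvalue_unimodular:
  assumes U: "isometry U" and g: "F g g \<noteq> 0" "\<And>w. F (U g) w = z * F g w"
  shows "cmod z = 1"
proof -
  have "F g g = z * F g (U g)" using isometry_F[OF U, of g g] g(2) by simp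
  also have "F g (U g) = cnj z * F g g" using g(2)[of g] herm by (metis complex_cnj_mult)
  finally have "z * cnj z = 1" using g(1) by simp
  hence "(cmod z)\<^sup>2 = 1" by (metis complex_norm_square of_real_eq_1_iff)
  thus ?thesis by (simp add: power2_eq_1_iff) (use norm_ge_zero[of z] in linarith)
qed

text \<open>Take an orthonormal system of eigenvectors of maximal length; orthonormality bounds the
  length by \<open>N\<close>. If some \<open>x\<close> violated Parseval's identity, its residual
  would generate a cyclic subspace orthogonal to the system and containing one more
  eigenvector.\<close>

lemma spectral_resolution:
  assumes U: "isometry U"
  obtains k :: nat and u z where
    "\<And>l. l < k \<Longrightarrow> cmod (z l) = 1"
    "\<And>l x. l < k \<Longrightarrow> F (U x) (u l) = z l * F x (u l)"
    "\<And>x y. F x y = (\<Sum>l<k. F x (u l) * cnj (F y (u l)))"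
proof -
  define ON where "ON = (\<lambda>k (u :: nat \<Rightarrow> nat \<Rightarrow> complex) z.
    (\<forall>l<k. \<forall>l'<k. F (u l) (u l') = (if l = l' then 1 else 0)) \<and>
    (\<forall>l<k. \<forall>w. F (U (u l)) w = z l * F (u l) w))"
  define P where "P = (\<lambda>k. \<exists>u z. ON k u z)"
  have bound: "k \<le> N" if "P k" for k
  proof (rule ccontr)
    assume "\<not> k \<le> N"
    obtain u z where ON: "ON k u z" using \<open>P k\<close> by (auto simp: P_def)
    obtain \<alpha> where \<alpha>: "\<exists>l\<in>{..<k}. \<alpha> l \<noteq> 0" "\<forall>t<N. (\<Sum>l<k. \<alpha> l * u l t) = 0"
      using linear_dependence[of "{..<k}" N u] \<open>\<not> k \<le> N\<close> by auto
    have "\<alpha> l = 0" if "l < k" for l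
    proof -
      have "0 = F (\<lambda>t. \<Sum>l<k. \<alpha> l * u l t) (u l)" by (rule supp[symmetric]) (use \<alpha> in simp)
      also have "\<dots> = (\<Sum>l'<k. \<alpha> l' * F (u l') (u l))" by (rule F_sum) simp
      also have "\<dots> = (\<Sum>l'<k. if l' = l then \<alpha> l' else 0)"
        using ON that by (intro sum.cong) (auto simp: ON_def)
      finally show ?thesis using that by simp
    qed
    thus False using \<alpha>(1) by auto
  qed
  have "P 0" by (simp add: P_def ON_def)
  then obtain k where k: "P k" and max: "\<And>k'. P k' \<Longrightarrow> k' \<le> k"
    using bound Nat.ex_has_greatest_nat[of P 0 N] by blast
  obtain u z where ON: "ON k u z" using k by (auto simp: P_def)
  have orth: "F (u l) (u l') = (if l = l' then 1 else 0)" if "l < k" "l' < k" for l l'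
    using ON that by (simp add: ON_def)
  have eig: "F (U (u l)) w = z l * F (u l) w" if "l < k" for l w
    using ON that by (simp add: ON_def)
  have z: "cmod (z l) = 1" if "l < k" for l
    using eigenvalue_unimodular[OF U, of "u l" "z l"] eig orth that by simp
  \<comment> \<open>An eigenvector of \<open>U\<close> is also one of its adjoint: apply the
    isometry to both arguments and use that \<open>z l\<close> and \<open>cnj (z l)\<close> are
    inverse to each other.\<close>
  have Uu: "F (U x) (u l) = z l * F x (u l)" if "l < k" for x l
  proof -
    have "F x (u l) = F (U x) (U (u l))" by (simp add: isometry_F[OF U])
    also have "\<dots> = cnj (z l) * F (U x) (u l)"
      using eig[OF that, of "U x"] herm by (metis complex_cnj_mult)
    finally have "z l * F x (u l) = (z l * cnj (z l)) * F (U x) (u l)" by simp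
    moreover have "z l * cnj (z l) = 1" using z[OF that] by (metis complex_norm_square of_real_1 power_one)
    ultimately show ?thesis by simp
  qed
  have "F x y = (\<Sum>l<k. F x (u l) * cnj (F y (u l)))" for x y
  proof -
    define h where "h = (\<lambda>t. (-1) * (\<Sum>l<k. F x (u l) * u l t) + x t)"
    have Fh: "F h w = F x w - (\<Sum>l<k. F x (u l) * F (u l) w)" for w
      unfolding h_def lin by (simp add: F_sum)
    have hu: "F h (u l) = 0" if "l < k" for l
    proof -
      have "(\<Sum>l'<k. F x (u l') * F (u l') (u l)) = (\<Sum>l'<k. if l' = l then F x (u l') else 0)"
        using that by (intro sum.cong) (auto simp: orth)
      thus ?thesis using that by (simp add: Fh)
    qed
    have "F h h = 0"
    proof (rule ccontr)
      assume "F h h \<noteq> 0"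
      obtain g a \<zeta> K where g: "g = (\<lambda>t. \<Sum>i<K. a i * (U ^^ i) h t)" "F g g \<noteq> 0"
        "\<And>w. F (U g) w = \<zeta> * F g w"
        by (rule eigenvector_in_cyclic_subspace[OF U \<open>F h h \<noteq> 0\<close>]) (rule that)
      \<comment> \<open>By \<open>Uu\<close> the orthogonal complement of the system is invariant
        under \<open>U\<close>.\<close>
      have "F ((U ^^ i) h) (u l) = 0" if "l < k" for i l
        using that by (induction i) (auto simp add: hu Uu)
      hence gu: "F g (u l) = 0" if "l < k" for l using that by (simp add: g(1) F_sum)
      define r where "r = complex_of_real (1 / sqrt (Re (F g g)))"
      have "Re (F g g) > 0" using g(2) pos[of g] F_self[of g] by (cases "Re (F g g) = 0") auto
      hence "1 / sqrt (Re (F g g)) * (1 / sqrt (Re (F g g))) * Re (F g g) = 1" by simp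
      hence rr: "r * cnj r * F g g = 1"
        by (subst F_self) (simp only: r_def complex_cnj_complex_of_real flip: of_real_mult, simp)
      define g' where "g' = (\<lambda>t. r * g t)"
      have 1: "F g' w = r * F g w" "F w g' = cnj r * F w g" for w
        by (simp_all add: g'_def F_scale F_scale_right)
      have Ug': "F (U g') w = \<zeta> * F g' w" for w
      proof -
        \<comment> \<open>Homogeneity of \<open>U\<close>, read off from a sum with one
          term.\<close>
        have "U g' = (\<lambda>t. \<Sum>l\<in>{..<1::nat}. r * U g t)"
          using isometry_sum[OF U, of "{..<1::nat}" "\<lambda>_. r" "\<lambda>_. g"] by (simp add: g'_def)
        hence "U g' = (\<lambda>t. r * U g t)" by simp
        thus ?thesis by (simp add: F_scale g(3) 1)
      qed
      have "F (u l) g = 0" if "l < k" for l using gu[OF that] herm by (metis complex_cnj_zero)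
      hence "ON (Suc k) (u(k := g')) (z(k := \<zeta>))"
        using rr by (auto simp: ON_def less_Suc_eq orth eig Ug' 1 gu ac_simps)
      hence "P (Suc k)" by (auto simp: P_def)
      thus False using max by fastforce
    qed
    hence "F h y = 0" by (rule null)
    moreover have "F (u l) y = cnj (F y (u l))" for l by (rule herm)
    ultimately show ?thesis by (simp add: Fh)
  qed
  thus ?thesis using that[of k z u] z Uu by blast
qed

end

subsection \<open>Positive block Toeplitz matrices\<close>

lemma block_index_less: "i < n \<Longrightarrow> r < m \<Longrightarrow> i * m + r < n * (m::nat)"
  using mult_le_mono1[of "Suc i" n m] by simp

lemma block_index_cases:
  assumes "g < n * (m::nat)"
  shows "g div m < n" "g mod m < m" "g = g div m * m + g mod m"
  using assms by (auto simp: less_mult_imp_div_less intro!: mod_less_divisor gr0I)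

lemma sum_block_index:
  "(\<Sum>g<n * m. f g) = (\<Sum>i<n. \<Sum>r<m. f (i * m + r :: nat))" for f :: "nat \<Rightarrow> 'a::comm_monoid_add"
proof -
  have "sum f {i * m..<i * m + m} = (\<Sum>r<m. f (i * m + r))" for i
    by (rule sum.reindex_bij_witness[of _ "\<lambda>r. i * m + r" "\<lambda>g. g - i * m"]) auto
  thus ?thesis by (simp flip: sum.nat_group)
qed

text \<open>The sesquilinear form \<open><A x, y>\<close>, linear in \<open>x\<close>. Its arguments
  are functions on all of \<open>nat\<close>, the vectors of the locale
  \<open>semi_inner\<close>.\<close>

definition quad_form :: "nat \<Rightarrow> complex mat \<Rightarrow> (nat \<Rightarrow> complex) \<Rightarrow> (nat \<Rightarrow> complex) \<Rightarrow> complex" where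
  "quad_form d A x y = (\<Sum>i<d. \<Sum>j<d. A $$ (i, j) * x j * cnj (y i))"

lemma psd_iff_quad_form:
  "psd d A \<longleftrightarrow> A \<in> carrier_mat d d \<and> (\<forall>x. 0 \<le> quad_form d A x x)"
proof -
  have *: "(A *\<^sub>v v) \<bullet>c v = quad_form d A (($) v) (($) v)"
    if "A \<in> carrier_mat d d" "v \<in> carrier_vec d" for v
    using that by (simp add: scalar_prod_def quad_form_def sum_distrib_right lessThan_atLeast0)
  have "quad_form d A (($) (vec d x)) (($) (vec d x)) = quad_form d A x x" for x
    by (simp add: quad_form_def)
  thus ?thesis unfolding psd_def using * by (metis vec_carrier)
qed

lemma psd_carrier: "psd d A \<Longrightarrow> A \<in> carrier_mat d d"
  by (simp add: psd_def)

lemma psd_sum: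
  assumes "M \<in> carrier_mat d d" "\<And>l. l \<in> S \<Longrightarrow> psd d (A l)"
    and "\<And>i j. i < d \<Longrightarrow> j < d \<Longrightarrow> M $$ (i, j) = (\<Sum>l\<in>S. A l $$ (i, j))"
  shows "psd d M"
proof -
  have "quad_form d M x x = (\<Sum>l\<in>S. quad_form d (A l) x x)" for x
  proof -
    have "quad_form d M x x = (\<Sum>i<d. \<Sum>j<d. \<Sum>l\<in>S. A l $$ (i, j) * x j * cnj (x i))"
      by (simp add: quad_form_def assms(3) sum_distrib_right)
    also have "\<dots> = (\<Sum>i<d. \<Sum>l\<in>S. \<Sum>j<d. A l $$ (i, j) * x j * cnj (x i))"
      by (intro sum.cong refl sum.swap)
    also have "\<dots> = (\<Sum>l\<in>S. quad_form d (A l) x x)"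
      unfolding quad_form_def by (rule sum.swap)
    finally show ?thesis .
  qed
  thus ?thesis using assms(1,2) by (auto simp: psd_iff_quad_form intro: sum_nonneg)
qed

text \<open>The form of \<open>g g*\<close> at \<open>x\<close> is the squared modulus of the inner
  product of \<open>x\<close> with \<open>g\<close>.\<close>

lemma psd_rank_one:
  assumes "M \<in> carrier_mat d d" "\<And>i j. i < d \<Longrightarrow> j < d \<Longrightarrow> M $$ (i, j) = g i * cnj (g j)"
  shows "psd d M"
proof -
  have "quad_form d M x x = (\<Sum>j<d. cnj (g j) * x j) * cnj (\<Sum>i<d. cnj (g i) * x i)" for x
    unfolding quad_form_def cnj_sum sum_product
    by (subst sum.swap) (simp add: assms(2) ac_simps)
  hence "quad_form d M x x = of_real ((cmod (\<Sum>j<d. cnj (g j) * x j))\<^sup>2)" for x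
    by (simp only: complex_norm_square)
  thus ?thesis using assms(1) by (simp add: psd_iff_quad_form less_eq_complex_def)
qed

lemma psd_sum_rank_one:
  assumes "M \<in> carrier_mat d d"
    and "\<And>i j. i < d \<Longrightarrow> j < d \<Longrightarrow> M $$ (i, j) = (\<Sum>l\<in>S. g l i * cnj (g l j))"
  shows "psd d M"
  by (rule psd_sum[where A = "\<lambda>l. mat d d (\<lambda>(i, j). g l i * cnj (g l j))" and S = S])
    (auto simp: assms intro: psd_rank_one)

lemma semi_inner_quad_form:
  assumes "psd d A"
  shows "semi_inner (quad_form d A) d"
proof
  let ?F = "quad_form d A"
  show lin: "?F (\<lambda>i. c * x i + y i) w = c * ?F x w + ?F y w" for c x y w
    by (simp add: quad_form_def sum_distrib_left sum.distrib algebra_simps)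
  have lin': "?F w (\<lambda>i. c * x i + y i) = cnj c * ?F w x + ?F w y" for c x y w
    by (simp add: quad_form_def sum_distrib_left sum.distrib algebra_simps)
  have ge: "0 \<le> ?F x x" for x using assms by (simp add: psd_iff_quad_form)
  thus "0 \<le> Re (?F x x)" for x by (simp add: less_eq_complex_def)
  have im: "Im (?F x x) = 0" for x using ge[of x] by (simp add: less_eq_complex_def)
  show "?F y x = cnj (?F x y)" for x y
  proof -
    \<comment> \<open>Polarisation: \<open>c = 1\<close> compares the imaginary parts of
      \<open>F x y\<close> and \<open>F y x\<close>, and \<open>c = \<i>\<close> their real
      parts.\<close>
    have "Im (c * (cnj c * ?F x x + ?F x y) + (cnj c * ?F y x + ?F y y)) = 0" for c
      using im[of "\<lambda>i. c * x i + y i"] by (simp only: lin lin')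
    from this[of 1] this[of \<i>] show ?thesis
      using im[of x] im[of y] by (intro complex_eqI) simp_all
  qed
  show "(\<And>i. i < d \<Longrightarrow> x i = 0) \<Longrightarrow> ?F x w = 0" for x w
    by (simp add: quad_form_def)
qed

text \<open>In the semi-inner product defined by \<open>A\<close>, the shift \<open>e(b, j) \<mapsto> e(b, j + 1)\<close> is isometric
  because the blocks of \<open>A\<close> are Toeplitz matrices; diagonalise an isometric extension of it.\<close>
lemma psd_block_toeplitz_decomposition:
  assumes psd: "psd (p * n) A" and toep: "\<And>a b. a < p \<Longrightarrow> b < p \<Longrightarrow> block n A a b \<in> toeplitz n"
  obtains L :: nat and g z where "\<And>l. l < L \<Longrightarrow> cmod (z l) = 1"
    "\<And>a b i j. a < p \<Longrightarrow> b < p \<Longrightarrow> i < n \<Longrightarrow> j < n \<Longrightarrow>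
      A $$ (a * n + i, b * n + j) = (\<Sum>l<L. g l a * cnj (g l b) * (z l ^ i * cnj (z l) ^ j))"
proof -
  define d where "d = p * n"
  define F where "F = quad_form d A"
  interpret semi_inner F d
    unfolding F_def d_def by (rule semi_inner_quad_form[OF psd])
  define e where "e = (\<lambda>s t :: nat. if t = s then 1 else 0 :: complex)"
  have Fe: "F (e t) (e s) = A $$ (s, t)" if "s < d" "t < d" for s t
  proof -
    have "(\<Sum>j<d. A $$ (i, j) * e t j * cnj (e s i)) = (\<Sum>j<d. if j = t then A $$ (i, t) * cnj (e s i) else 0)" for i
      by (rule sum.cong) (auto simp: e_def)
    hence "F (e t) (e s) = (\<Sum>i<d. A $$ (i, t) * cnj (e s i))"
      using that by (simp add: F_def quad_form_def)
    also have "\<dots> = (\<Sum>i<d. if i = s then A $$ (s, t) else 0)"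
      by (rule sum.cong) (auto simp: e_def)
    finally show ?thesis using that by simp
  qed
  have shift: "A $$ (a * n + Suc i, b * n + Suc j) = A $$ (a * n + i, b * n + j)"
    if "a < p" "b < p" "Suc i < n" "Suc j < n" for a b i j
  proof -
    obtain \<tau> where \<tau>: "block n A a b = mat n n (\<lambda>(k, l). \<tau> (int k - int l))"
      using toep[OF \<open>a < p\<close> \<open>b < p\<close>] by (auto simp: toeplitz_def)
    hence *: "A $$ (a * n + i, b * n + j) = \<tau> (int i - int j)" if "i < n" "j < n" for i j
    proof -
      have "A $$ (a * n + i, b * n + j) = block n A a b $$ (i, j)" using that by (simp add: block_def)
      also have "\<dots> = \<tau> (int i - int j)" using that \<tau> by simp
      finally show ?thesis .
    qed
    show ?thesis using that *[of i j] *[of "Suc i" "Suc j"] by simp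
  qed
  have less: "a * n + i < d" if "a < p" "i < n" for a i
    using that by (simp add: d_def block_index_less)
  \<comment> \<open>An index \<open>k < p * (n - 1)\<close> encodes a pair \<open>(b, j)\<close>
    with \<open>j < n - 1\<close>, that is, a basis vector whose successor lies in the same
    block.\<close>
  define x where "x = (\<lambda>k. e (k div (n - 1) * n + k mod (n - 1)))"
  define y where "y = (\<lambda>k. e (k div (n - 1) * n + Suc (k mod (n - 1))))"
  have "F (x k) (x l) = F (y k) (y l)" if "k < p * (n - 1)" "l < p * (n - 1)" for k l
  proof -
    note k = block_index_cases[OF that(1)] and l = block_index_cases[OF that(2)]
    have lt: "Suc (k mod (n - 1)) < n" "Suc (l mod (n - 1)) < n" using k(2) l(2) by linarith+
    have eq: "F (x k) (x l) = A $$ (l div (n - 1) * n + l mod (n - 1), k div (n - 1) * n + k mod (n - 1))"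
      unfolding x_def by (rule Fe; rule less) (use k l lt in auto)
    have "F (y k) (y l) = A $$ (l div (n - 1) * n + Suc (l mod (n - 1)), k div (n - 1) * n + Suc (k mod (n - 1)))"
      unfolding y_def by (rule Fe; rule less) (use k l lt in auto)
    thus ?thesis unfolding eq using shift[OF l(1) k(1) lt(2,1)] by simp
  qed
  then obtain U where U: "isometry U" "\<And>k w. k < p * (n - 1) \<Longrightarrow> F (U (x k)) w = F (y k) w"
    using isometry_extension[of "p * (n - 1)" x y] by blast
  have Ue: "F (U (e (b * n + j))) w = F (e (b * n + Suc j)) w" if "b < p" "Suc j < n" for b j w
  proof -
    have "b * (n - 1) + j < p * (n - 1)" using that by (intro block_index_less) auto
    moreover have "(b * (n - 1) + j) div (n - 1) = b" "(b * (n - 1) + j) mod (n - 1) = j"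
      using that by auto
    ultimately show ?thesis using U(2)[of "b * (n - 1) + j" w] by (simp add: x_def y_def)
  qed
  obtain L :: nat and u z where z: "\<And>l. l < L \<Longrightarrow> cmod (z l) = 1"
    and Uu: "\<And>l x. l < L \<Longrightarrow> F (U x) (u l) = z l * F x (u l)"
    and res: "\<And>x y. F x y = (\<Sum>l<L. F x (u l) * cnj (F y (u l)))"
    by (rule spectral_resolution[OF U(1)]) (rule that)
  have pow: "F (e (b * n + j)) (u l) = z l ^ j * F (e (b * n)) (u l)" if "b < p" "j < n" "l < L" for b j l
    using that(2)
  proof (induction j)
    case (Suc j)
    thus ?case using Ue[OF that(1) Suc.prems, of "u l"] Uu[OF that(3)] by (simp add: mult.assoc)
  qed simp
  show ?thesis
  proof (rule that)
    \<comment> \<open>The first argument of \<open>F\<close> carries the column index of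
      \<open>A\<close>, so the powers of \<open>z l\<close> belong to columns; the nodes wanted are
      the conjugates.\<close>
    show "cmod (cnj (z l)) = 1" if "l < L" for l using z[OF that] by simp
    fix a b i j assume *: "a < p" "b < p" "i < n" "j < n"
    have "A $$ (a * n + i, b * n + j) = F (e (b * n + j)) (e (a * n + i))"
      using * by (simp add: Fe less)
    also have "\<dots> = (\<Sum>l<L. F (e (b * n + j)) (u l) * cnj (F (e (a * n + i)) (u l)))" by (rule res)
    also have "\<dots> = (\<Sum>l<L. cnj (F (e (a * n)) (u l)) * cnj (cnj (F (e (b * n)) (u l))) *
        (cnj (z l) ^ i * cnj (cnj (z l)) ^ j))"
      using * by (intro sum.cong) (simp_all add: pow)
    finally show "A $$ (a * n + i, b * n + j) = \<dots>" .
  qed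
qed

text \<open>Every matrix is a block matrix with blocks of size one, and these are trivially
  Toeplitz; all powers of the nodes then have exponent zero.\<close>

lemma psd_decomposition:
  assumes "psd d A"
  obtains L :: nat and g where
    "\<And>i j. i < d \<Longrightarrow> j < d \<Longrightarrow> A $$ (i, j) = (\<Sum>l<L. g l i * cnj (g l j))"
proof -
  have toep: "block 1 A a b \<in> toeplitz 1" for a b
    by (rule toeplitzI[of _ _ "\<lambda>_. A $$ (a, b)"]) (auto simp: block_def)
  have "psd (d * 1) A" using assms by simp
  then obtain L :: nat and g z where *: "\<And>a b i j. a < d \<Longrightarrow> b < d \<Longrightarrow> i < (1::nat) \<Longrightarrow> j < (1::nat) \<Longrightarrow>
      A $$ (a * 1 + i, b * 1 + j) = (\<Sum>l<L. g l a * cnj (g l b) * (z l ^ i * cnj (z l) ^ j))"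
    by (rule psd_block_toeplitz_decomposition[of d 1 A, OF _ toep]) (rule that)
  show ?thesis by (rule that) (use *[of _ _ 0 0] in simp)
qed

text \<open>Decompose both factors into rank one terms: the product of \<open>g g*\<close> and
  \<open>h h*\<close> is the rank one matrix of \<open>g \<otimes> h\<close>.\<close>

lemma psd_kron:
  assumes A: "psd k A" and B: "psd q B"
  shows "psd (k * q) (kron A B)"
proof -
  obtain L :: nat and g where g: "\<And>i j. i < k \<Longrightarrow> j < k \<Longrightarrow> A $$ (i, j) = (\<Sum>l<L. g l i * cnj (g l j))"
    by (rule psd_decomposition[OF A]) (rule that)
  obtain M :: nat and h where h: "\<And>i j. i < q \<Longrightarrow> j < q \<Longrightarrow> B $$ (i, j) = (\<Sum>l<M. h l i * cnj (h l j))"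
    by (rule psd_decomposition[OF B]) (rule that)
  note car = psd_carrier[OF A] psd_carrier[OF B]
  show ?thesis
  proof (rule psd_sum_rank_one)
    show "kron A B \<in> carrier_mat (k * q) (k * q)" using car by (simp add: kron_def)
    fix i j assume ij: "i < k * q" "j < k * q"
    note i = block_index_cases[OF ij(1)] and j = block_index_cases[OF ij(2)]
    have "kron A B $$ (i, j) = A $$ (i div q, j div q) * B $$ (i mod q, j mod q)"
      using car ij by (simp add: kron_def)
    also have "\<dots> = (\<Sum>(l, l')\<in>{..<L} \<times> {..<M}. (g l (i div q) * h l' (i mod q)) * cnj (g l (j div q) * h l' (j mod q)))"
      using i j by (simp add: g h sum_product sum.cartesian_product ac_simps)
    finally show "kron A B $$ (i, j) = (\<Sum>s\<in>{..<L} \<times> {..<M}.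
        (case s of (l, l') \<Rightarrow> \<lambda>i. g l (i div q) * h l' (i mod q)) i *
        cnj ((case s of (l, l') \<Rightarrow> \<lambda>i. g l (i div q) * h l' (i mod q)) j))"
      by (simp add: case_prod_unfold)
  qed
qed

lemma psd_sum_kron:
  assumes "\<And>j. j < l \<Longrightarrow> psd k (a j) \<and> psd q (b j)"
  shows "psd (k * q) (sum_kron (k * q) l a b)"
  by (rule psd_sum[where A = "\<lambda>j. kron (a j) (b j)" and S = "{..<l}"])
    (use assms in \<open>auto simp: sum_kron_def intro: psd_kron\<close>)

subsection \<open>Moments of atomic measures on the torus\<close>

text \<open>More than \<open>D\<close> vectors satisfy a linear relation with some positive
  coefficient. Subtracting the largest multiple of it that keeps all weights nonnegative removes one
  vector from the sum.\<close>

lemma caratheodory_cone: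
  fixes f :: "'l \<Rightarrow> nat \<Rightarrow> real"
  assumes "finite S" "\<And>l. l \<in> S \<Longrightarrow> 0 \<le> c l"
  shows "\<exists>T c'. T \<subseteq> S \<and> card T \<le> D \<and> (\<forall>l\<in>T. 0 \<le> c' l) \<and>
    (\<forall>i<D. (\<Sum>l\<in>T. c' l * f l i) = (\<Sum>l\<in>S. c l * f l i))"
  using assms
proof (induction "card S" arbitrary: S c rule: less_induct)
  case less
  show ?case
  proof (cases "card S \<le> D")
    case True
    thus ?thesis using less.prems by blast
  next
    case False
    obtain \<beta> where \<beta>: "\<exists>l\<in>S. \<beta> l \<noteq> 0" "\<forall>i<D. (\<Sum>l\<in>S. \<beta> l * f l i) = 0"
      using linear_dependence[of S D f] less.prems False by auto
    obtain \<alpha> where \<alpha>: "\<exists>l\<in>S. \<alpha> l > 0" "\<forall>i<D. (\<Sum>l\<in>S. \<alpha> l * f l i) = 0"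
    proof (cases "\<exists>l\<in>S. \<beta> l > 0")
      case True
      thus ?thesis using that \<beta>(2) by blast
    next
      case False
      hence "\<exists>l\<in>S. - \<beta> l > 0" using \<beta>(1) by force
      moreover have "\<forall>i<D. (\<Sum>l\<in>S. - \<beta> l * f l i) = 0" using \<beta>(2) by (simp add: sum_negf)
      ultimately show ?thesis using that[of "\<lambda>l. - \<beta> l"] by blast
    qed
    define P where "P = {l \<in> S. \<alpha> l > 0}"
    have P: "finite P" "P \<noteq> {}" using less.prems \<alpha>(1) by (auto simp: P_def)
    \<comment> \<open>The smallest ratio over the positive coefficients: its minimiser
      \<open>l0\<close> loses all its weight, and no other weight turns negative.\<close>
    define t where "t = Min ((\<lambda>l. c l / \<alpha> l) ` P)"
    have "t \<in> (\<lambda>l. c l / \<alpha> l) ` P" unfolding t_def using P by (intro Min_in) auto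
    then obtain l0 where l0: "l0 \<in> P" "t = c l0 / \<alpha> l0" by blast
    have t0: "t \<ge> 0" using l0 less.prems by (auto simp: P_def)
    have tle: "t \<le> c l / \<alpha> l" if "l \<in> P" for l
      unfolding t_def using P that by (intro Min_le) auto
    define c' where "c' = (\<lambda>l. c l - t * \<alpha> l)"
    have c': "0 \<le> c' l" if "l \<in> S" for l
    proof (cases "\<alpha> l > 0")
      case True
      thus ?thesis using tle[of l] that by (simp add: P_def c'_def field_simps)
    next
      case False
      hence "t * \<alpha> l \<le> 0" using t0 by (simp add: mult_nonneg_nonpos)
      thus ?thesis using less.prems(2)[OF that] by (simp add: c'_def)
    qed
    have l0S: "l0 \<in> S" "c' l0 = 0" using l0 by (auto simp: P_def c'_def)
    have sum_eq: "(\<Sum>l\<in>S - {l0}. c' l * f l i) = (\<Sum>l\<in>S. c l * f l i)" if "i < D" for i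
    proof -
      have "(\<Sum>l\<in>S - {l0}. c' l * f l i) = (\<Sum>l\<in>S. c' l * f l i)"
        using less.prems l0S by (simp add: sum.remove[of S l0])
      also have "\<dots> = (\<Sum>l\<in>S. c l * f l i) - t * (\<Sum>l\<in>S. \<alpha> l * f l i)"
        by (simp add: c'_def sum_distrib_left left_diff_distrib sum_subtractf mult.assoc)
      finally show ?thesis using \<alpha>(2) that by simp
    qed
    have "card (S - {l0}) < card S" using less.prems l0S by (intro psubset_card_mono) auto
    from less.hyps[OF this, of c'] less.prems(1) c'
    obtain T c'' where "T \<subseteq> S - {l0}" "card T \<le> D" "\<forall>l\<in>T. 0 \<le> c'' l"
      "\<forall>i<D. (\<Sum>l\<in>T. c'' l * f l i) = (\<Sum>l\<in>S - {l0}. c' l * f l i)" by auto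
    thus ?thesis using sum_eq by (intro exI[of _ T] exI[of _ c'']) auto
  qed
qed

text \<open>Bolzano-Weierstrass for one coordinate after another, each time passing to a further
  subsequence.\<close>

lemma bounded_simultaneously_convergent_subsequence:
  fixes f :: "nat \<Rightarrow> nat \<Rightarrow> complex" and D :: nat
  assumes "\<And>i k. i < D \<Longrightarrow> cmod (f k i) \<le> B"
  obtains r g where "strict_mono r" "\<And>i. i < D \<Longrightarrow> (\<lambda>k. f (r k) i) \<longlonglongrightarrow> g i"
proof -
  have "\<exists>r g. strict_mono (r :: nat \<Rightarrow> nat) \<and> (\<forall>i<D. (\<lambda>k. f (r k) i) \<longlonglongrightarrow> g i)"
    using assms
  proof (induction D)
    case 0
    have "strict_mono (id :: nat \<Rightarrow> nat)" by (simp add: strict_mono_def)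
    thus ?case by blast
  next
    case (Suc D)
    then obtain r g where r: "strict_mono (r :: nat \<Rightarrow> nat)" "\<And>i. i < D \<Longrightarrow> (\<lambda>k. f (r k) i) \<longlonglongrightarrow> g i"
      by (metis less_SucI)
    have "\<exists>s y. strict_mono (s :: nat \<Rightarrow> nat) \<and> (\<forall>e>0. \<exists>N. \<forall>n\<ge>N. cmod (f (r (s n)) D - y) < e)"
      by (rule Bolzano_Weierstrass_complex_disc[of "\<lambda>k. f (r k) D" B]) (use Suc.prems in auto)
    then obtain s y where s: "strict_mono (s :: nat \<Rightarrow> nat)"
        "\<forall>e>0. \<exists>N. \<forall>n\<ge>N. cmod (f (r (s n)) D - y) < e" by blast
    have "(\<lambda>k. f ((r \<circ> s) k) i) \<longlonglongrightarrow> (g(D := y)) i" if "i < Suc D" for i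
    proof (cases "i = D")
      case True
      thus ?thesis using s(2) by (simp add: LIMSEQ_iff)
    next
      case False
      thus ?thesis using LIMSEQ_subseq_LIMSEQ[OF r(2) s(1), of i] that by (simp add: o_def)
    qed
    thus ?case using strict_mono_o[OF r(1) s(1)] by blast
  qed
  thus ?thesis using that by blast
qed

text \<open>The vector \<open>(w^i) \<otimes> (z^r)\<close>, whose coordinate \<open>(i, r)\<close>
  has the number \<open>i * m + r\<close>.\<close>

definition torus_vec :: "nat \<Rightarrow> complex \<Rightarrow> complex \<Rightarrow> nat \<Rightarrow> complex" where
  "torus_vec m w z g = w ^ (g div m) * z ^ (g mod m)"

text \<open>\<open>x\<close> is a matrix of trigonometric moments of a finitely supported positive measure on the
  torus, with mass \<open>c l\<close> at the point \<open>(w l, z l)\<close>.\<close>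
definition atomic :: "nat \<Rightarrow> nat \<Rightarrow> complex mat \<Rightarrow> bool" where
  "atomic n m x \<longleftrightarrow> x \<in> carrier_mat (n * m) (n * m) \<and>
    (\<exists>L c w z. (\<forall>l<L::nat. 0 \<le> c l \<and> cmod (w l) = 1 \<and> cmod (z l) = 1) \<and>
      (\<forall>g<n * m. \<forall>h<n * m. x $$ (g, h) =
        (\<Sum>l<L. complex_of_real (c l) * (torus_vec m (w l) (z l) g * cnj (torus_vec m (w l) (z l) h)))))"

lemma atomicI:
  assumes "x \<in> carrier_mat (n * m) (n * m)" "finite S"
    and "\<And>l. l \<in> S \<Longrightarrow> 0 \<le> c l \<and> cmod (w l) = 1 \<and> cmod (z l) = 1"
    and "\<And>g h. g < n * m \<Longrightarrow> h < n * m \<Longrightarrow> x $$ (g, h) =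
      (\<Sum>l\<in>S. complex_of_real (c l) * (torus_vec m (w l) (z l) g * cnj (torus_vec m (w l) (z l) h)))"
  shows "atomic n m x"
proof -
  obtain e where e: "bij_betw e {..<card S} S"
    using ex_bij_betw_nat_finite[OF assms(2)] by (auto simp: lessThan_atLeast0)
  have "e l \<in> S" if "l < card S" for l using e that by (auto simp: bij_betw_def)
  thus ?thesis
    unfolding atomic_def using assms(1,3,4)
    by (intro conjI exI[of _ "card S"] exI[of _ "c \<circ> e"] exI[of _ "w \<circ> e"] exI[of _ "z \<circ> e"])
      (auto simp flip: sum.reindex_bij_betw[OF e])
qed

text \<open>On the unit circle \<open>cnj w\<close> is the inverse of \<open>w\<close>, so the
  product depends only on \<open>i - j\<close>. This is the source of all Toeplitz structure
  below.\<close>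

lemma unimodular_power:
  assumes "cmod w = 1"
  shows "w ^ i * cnj w ^ j = (if j \<le> i then w ^ (i - j) else cnj w ^ (j - i))"
proof -
  have "w * cnj w = 1" using assms by (metis complex_norm_square of_real_1 power_one)
  hence *: "w ^ k * cnj w ^ k = 1" for k by (metis power_mult_distrib power_one)
  show ?thesis
  proof (cases "j \<le> i")
    case True
    hence "w ^ i * cnj w ^ j = w ^ (i - j) * (w ^ j * cnj w ^ j)"
      by (simp flip: power_add mult.assoc)
    thus ?thesis using True * by simp
  next
    case False
    hence "w ^ i * cnj w ^ j = (w ^ i * cnj w ^ i) * cnj w ^ (j - i)"
      by (simp flip: power_add add: mult.assoc)
    thus ?thesis using False * by simp
  qed
qed

lemma toeplitz_atom:
  assumes "0 \<le> c" "cmod w = 1"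
  shows "mat n n (\<lambda>(i, j). complex_of_real c * (w ^ i * cnj w ^ j)) \<in> pos_cone n (toeplitz n)"
proof -
  let ?A = "mat n n (\<lambda>(i, j). complex_of_real c * (w ^ i * cnj w ^ j))"
  have "?A = mat n n (\<lambda>(i, j). (\<lambda>d. complex_of_real c * (if d \<ge> 0 then w ^ nat d else cnj w ^ nat (- d))) (int i - int j))"
    by (rule eq_matI) (auto simp: unimodular_power[OF assms(2)] nat_diff_distrib' of_nat_diff)
  hence "?A \<in> toeplitz n" by (rule toeplitzI)
  moreover have "psd n ?A"
  proof (rule psd_rank_one)
    have "complex_of_real c = complex_of_real (sqrt c) * complex_of_real (sqrt c)"
      using assms(1) by (simp flip: of_real_mult)
    thus "?A $$ (i, j) = complex_of_real (sqrt c) * w ^ i * cnj (complex_of_real (sqrt c) * w ^ j)"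
      if "i < n" "j < n" for i j using that by simp
  qed simp
  ultimately show ?thesis by (simp add: pos_cone_def)
qed

text \<open>The atom at \<open>(w, z)\<close> is the Kronecker product of two positive rank one
  Toeplitz matrices; its mass is put into the first factor.\<close>

lemma atomic_imp_sep_cone:
  assumes "atomic n m x"
  shows "x \<in> sep_cone n (toeplitz n) m (toeplitz m)"
proof -
  from assms obtain L c w z where car: "x \<in> carrier_mat (n * m) (n * m)"
    and cwz: "\<And>l. l < (L::nat) \<Longrightarrow> 0 \<le> c l \<and> cmod (w l) = 1 \<and> cmod (z l) = 1"
    and x: "\<And>g h. g < n * m \<Longrightarrow> h < n * m \<Longrightarrow> x $$ (g, h) =
      (\<Sum>l<L. complex_of_real (c l) * (torus_vec m (w l) (z l) g * cnj (torus_vec m (w l) (z l) h)))"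
    unfolding atomic_def by blast
  define a where "a = (\<lambda>l. mat n n (\<lambda>(i, j). complex_of_real (c l) * (w l ^ i * cnj (w l) ^ j)))"
  define b where "b = (\<lambda>l. mat m m (\<lambda>(i, j). complex_of_real 1 * (z l ^ i * cnj (z l) ^ j)))"
  have "\<forall>l<L. a l \<in> pos_cone n (toeplitz n) \<and> b l \<in> pos_cone m (toeplitz m)"
    using cwz unfolding a_def b_def by (blast intro: toeplitz_atom zero_le_one)
  moreover have "x = sum_kron (n * m) L a b"
  proof (rule eq_matI)
    fix g h assume "g < dim_row (sum_kron (n * m) L a b)" "h < dim_col (sum_kron (n * m) L a b)"
    hence gh: "g < n * m" "h < n * m" by (simp_all add: sum_kron_def)
    note g = block_index_cases[OF gh(1)] and h = block_index_cases[OF gh(2)]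
    have "sum_kron (n * m) L a b $$ (g, h) =
        (\<Sum>l<L. a l $$ (g div m, h div m) * b l $$ (g mod m, h mod m))"
      using sum_kron_index[of L a n b m "g div m" "h div m" "g mod m" "h mod m"] g h
      by (simp add: a_def b_def)
    also have "\<dots> = x $$ (g, h)"
      unfolding x[OF gh] by (rule sum.cong) (use g h in \<open>simp_all add: a_def b_def torus_vec_def\<close>)
    finally show "x $$ (g, h) = sum_kron (n * m) L a b $$ (g, h)" by simp
  qed (use car in \<open>simp_all add: sum_kron_def\<close>)
  ultimately show ?thesis unfolding sep_cone_def by blast
qed

section \<open>Closedness of the cone of moment matrices\<close>

lemma atomic_bounded_length:
  assumes "atomic n m x"
  obtains c w z where
    "\<And>l. l < 2 * (n * m * (n * m)) \<Longrightarrow> 0 \<le> c l \<and> cmod (w l) = 1 \<and> cmod (z l) = 1"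
    "\<And>g h. g < n * m \<Longrightarrow> h < n * m \<Longrightarrow> x $$ (g, h) =
      (\<Sum>l<2 * (n * m * (n * m)). complex_of_real (c l) *
        (torus_vec m (w l) (z l) g * cnj (torus_vec m (w l) (z l) h)))"
proof -
  from assms obtain L c w z where
    cwz: "\<And>l. l < (L::nat) \<Longrightarrow> 0 \<le> c l \<and> cmod (w l) = 1 \<and> cmod (z l) = 1"
    and x: "\<And>g h. g < n * m \<Longrightarrow> h < n * m \<Longrightarrow> x $$ (g, h) =
      (\<Sum>l<L. complex_of_real (c l) * (torus_vec m (w l) (z l) g * cnj (torus_vec m (w l) (z l) h)))"
    unfolding atomic_def by blast
  define K where "K = n * m"
  define E where "E = K * K"
  define v where "v = (\<lambda>l g h. torus_vec m (w l) (z l) g * cnj (torus_vec m (w l) (z l) h))"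
  \<comment> \<open>The \<open>2 * E\<close> real coordinates of an atom, for Caratheodory's
    theorem: the real parts of all entries first, then the imaginary parts, with entry
    \<open>(g, h)\<close> at offset \<open>g * K + h\<close>.\<close>
  define f where "f = (\<lambda>l t. let y = v l (t mod E div K) (t mod E mod K) in if t div E = 0 then Re y else Im y)"
  have "\<exists>T c'. T \<subseteq> {..<L} \<and> card T \<le> 2 * E \<and> (\<forall>l\<in>T. 0 \<le> c' l) \<and>
      (\<forall>t<2 * E. (\<Sum>l\<in>T. c' l * f l t) = (\<Sum>l<L. c l * f l t))"
    by (rule caratheodory_cone) (use cwz in auto)
  then obtain T c' where T: "T \<subseteq> {..<L}" "card T \<le> 2 * E" "\<forall>l\<in>T. 0 \<le> c' l"
    "\<forall>t<2 * E. (\<Sum>l\<in>T. c' l * f l t) = (\<Sum>l<L. c l * f l t)"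
    by blast
  have fin: "finite T" using T(1) finite_subset by blast
  have x': "x $$ (g, h) = (\<Sum>l\<in>T. complex_of_real (c' l) * v l g h)" if gh: "g < K" "h < K" for g h
  proof -
    have t: "g * K + h < E" using gh by (simp add: E_def block_index_less)
    have f: "f l (g * K + h) = Re (v l g h)" "f l (1 * E + (g * K + h)) = Im (v l g h)" for l
      using t gh by (simp_all add: f_def)
    have "(\<Sum>l\<in>T. c' l * Re (v l g h)) = (\<Sum>l<L. c l * Re (v l g h))"
      using T(4)[rule_format, of "g * K + h"] t by (simp add: f(1))
    moreover have "(\<Sum>l\<in>T. c' l * Im (v l g h)) = (\<Sum>l<L. c l * Im (v l g h))"
      using T(4)[rule_format, of "1 * E + (g * K + h)"] t unfolding f(2) by simp
    ultimately have "(\<Sum>l\<in>T. complex_of_real (c' l) * v l g h) = (\<Sum>l<L. complex_of_real (c l) * v l g h)"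
      by (simp add: complex_eq_iff)
    thus ?thesis using x gh by (simp add: K_def v_def)
  qed
  obtain e where e: "bij_betw e {..<card T} T"
    using ex_bij_betw_nat_finite[OF fin] by (auto simp: lessThan_atLeast0)
  have eT: "e l \<in> T" if "l < card T" for l using e that by (auto simp: bij_betw_def)
  \<comment> \<open>Atoms of mass zero at \<open>(1, 1)\<close> bring the number of atoms to exactly
    \<open>2 * E\<close>.\<close>
  define c1 where "c1 = (\<lambda>l. if l < card T then c' (e l) else 0)"
  define w1 where "w1 = (\<lambda>l. if l < card T then w (e l) else 1)"
  define z1 where "z1 = (\<lambda>l. if l < card T then z (e l) else 1)"
  show ?thesis
  proof (rule that)
    show "0 \<le> c1 l \<and> cmod (w1 l) = 1 \<and> cmod (z1 l) = 1" for l
      using eT[of l] T(1,3) cwz by (auto simp: c1_def w1_def z1_def)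
    fix g h assume gh: "g < n * m" "h < n * m"
    have "x $$ (g, h) = (\<Sum>l<card T. complex_of_real (c' (e l)) * v (e l) g h)"
      using x' gh by (simp add: K_def sum.reindex_bij_betw[OF e, of "\<lambda>l. complex_of_real (c' l) * v l g h"])
    also have "\<dots> = (\<Sum>l<2 * E. complex_of_real (c1 l) * (torus_vec m (w1 l) (z1 l) g * cnj (torus_vec m (w1 l) (z1 l) h)))"
      by (rule sum.mono_neutral_cong_left) (use T(2) in \<open>auto simp: c1_def w1_def z1_def v_def\<close>)
    finally show "x $$ (g, h) = (\<Sum>l<2 * (n * m * (n * m)). complex_of_real (c1 l) *
        (torus_vec m (w1 l) (z1 l) g * cnj (torus_vec m (w1 l) (z1 l) h)))"
      by (simp only: E_def K_def)
  qed
qed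

text \<open>All approximants have the same number of atoms, the points lie on the unit circle, and
  the masses are bounded because the entry at \<open>(0, 0)\<close> is the total mass. A limit along
  a subsequence therefore gives a measure for \<open>x\<close> itself.\<close>

lemma atomic_closed:
  assumes n: "n > 0" and m: "m > 0" and car: "x \<in> carrier_mat (n * m) (n * m)"
    and approx: "\<And>\<epsilon>. \<epsilon> > 0 \<Longrightarrow> atomic n m (complex_of_real \<epsilon> \<cdot>\<^sub>m 1\<^sub>m (n * m) + x)"
  shows "atomic n m x"
proof -
  define D where "D = 2 * (n * m * (n * m))"
  define \<epsilon> where "\<epsilon> = (\<lambda>k. inverse (real (Suc k)))"
  define V where "V = (\<lambda>w z g h. torus_vec m w z g * cnj (torus_vec m w z h))"
  define Q where "Q = (\<lambda>k c w z. (\<forall>l<D. 0 \<le> c l \<and> cmod (w l) = 1 \<and> cmod (z l) = 1) \<and>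
      (\<forall>g<n * m. \<forall>h<n * m. complex_of_real (\<epsilon> k) * 1\<^sub>m (n * m) $$ (g, h) + x $$ (g, h) =
        (\<Sum>l<D. complex_of_real (c l) * V (w l) (z l) g h)))"
  have "\<exists>c w z. Q k c w z" for k
  proof -
    have "\<epsilon> k > 0" by (simp add: \<epsilon>_def)
    from approx[OF this] obtain c w z where
      *: "\<And>l. l < D \<Longrightarrow> 0 \<le> c l \<and> cmod (w l) = 1 \<and> cmod (z l) = 1"
      "\<And>g h. g < n * m \<Longrightarrow> h < n * m \<Longrightarrow> (complex_of_real (\<epsilon> k) \<cdot>\<^sub>m 1\<^sub>m (n * m) + x) $$ (g, h) =
        (\<Sum>l<D. complex_of_real (c l) * V (w l) (z l) g h)"
      unfolding D_def V_def by (rule atomic_bounded_length) (rule that[unfolded D_def V_def])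
    have "(complex_of_real (\<epsilon> k) \<cdot>\<^sub>m 1\<^sub>m (n * m) + x) $$ (g, h) =
        complex_of_real (\<epsilon> k) * 1\<^sub>m (n * m) $$ (g, h) + x $$ (g, h)" if "g < n * m" "h < n * m" for g h
      using that car by (simp del: index_one_mat(1))
    thus ?thesis using * by (intro exI[of _ c] exI[of _ w] exI[of _ z]) (simp add: Q_def)
  qed
  then obtain c w z where "\<And>k. Q k (c k) (w k) (z k)" by metis
  hence cwz: "\<And>l. l < D \<Longrightarrow> 0 \<le> c k l \<and> cmod (w k l) = 1 \<and> cmod (z k l) = 1"
    and x: "\<And>g h. g < n * m \<Longrightarrow> h < n * m \<Longrightarrow>
      complex_of_real (\<epsilon> k) * 1\<^sub>m (n * m) $$ (g, h) + x $$ (g, h) =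
        (\<Sum>l<D. complex_of_real (c k l) * V (w k l) (z k l) g h)" for k
    by (auto simp: Q_def)
  \<comment> \<open>The summand 1 bounds every \<open>\<epsilon> k\<close>, and also the moduli of
    the points.\<close>
  define B where "B = 1 + cmod (x $$ (0, 0))"
  have cB: "c k l \<le> B" if "l < D" for k l
  proof -
    have "V w z 0 0 = 1" for w z by (simp add: V_def torus_vec_def)
    hence "complex_of_real (\<Sum>l<D. c k l) = complex_of_real (\<epsilon> k) + x $$ (0, 0)"
      using x[of 0 0 k] n m by simp
    hence "cmod (complex_of_real (\<Sum>l<D. c k l)) \<le> cmod (complex_of_real (\<epsilon> k)) + cmod (x $$ (0, 0))"
      by (simp only: norm_triangle_ineq)
    moreover have "cmod (complex_of_real (\<epsilon> k)) \<le> 1"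
      unfolding norm_of_real by (simp add: \<epsilon>_def field_simps)
    moreover have "c k l \<le> (\<Sum>l<D. c k l)"
      using that cwz by (intro member_le_sum) auto
    ultimately show ?thesis unfolding norm_of_real B_def by linarith
  qed
  \<comment> \<open>Masses and points are concatenated into \<open>3 * D\<close> coordinates so that
    one subsequence serves them all.\<close>
  define f where "f = (\<lambda>k i. if i < D then complex_of_real (c k i)
    else if i < 2 * D then w k (i - D) else z k (i - 2 * D))"
  have fB: "cmod (f k i) \<le> B" if "i < 3 * D" for k i
  proof -
    have "1 \<le> B" by (simp add: B_def)
    moreover have "cmod (f k i) \<le> B" if "i < D" using cB[OF that, of k] cwz[OF that, of k] that
      by (simp add: f_def)
    moreover have "cmod (f k i) = 1" if "\<not> i < D" "i < 2 * D" using cwz[of "i - D" k] that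
      by (simp add: f_def)
    moreover have "cmod (f k i) = 1" if "\<not> i < 2 * D" using cwz[of "i - 2 * D" k] that \<open>i < 3 * D\<close>
      by (simp add: f_def)
    ultimately show ?thesis by (metis (full_types))
  qed
  obtain r y where r: "strict_mono r" and y: "\<And>i. i < 3 * D \<Longrightarrow> (\<lambda>k. f (r k) i) \<longlonglongrightarrow> y i"
    by (rule bounded_simultaneously_convergent_subsequence[of "3 * D" f B, OF fB]) (assumption | rule that)+
  define C where "C = (\<lambda>l. Re (y l))"
  define W where "W = (\<lambda>l. y (D + l))"
  define Z where "Z = (\<lambda>l. y (2 * D + l))"
  have lim: "(\<lambda>k. c (r k) l) \<longlonglongrightarrow> C l" "(\<lambda>k. w (r k) l) \<longlonglongrightarrow> W l" "(\<lambda>k. z (r k) l) \<longlonglongrightarrow> Z l"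
    if "l < D" for l
    using tendsto_Re[OF y[of l]] y[of "D + l"] y[of "2 * D + l"] that
    by (simp_all add: f_def C_def W_def Z_def)
  show ?thesis
  proof (rule atomicI[OF car, of "{..<D}" C W Z])
    fix l assume "l \<in> {..<D}"
    hence l: "l < D" by simp
    have "C l \<ge> 0" using LIMSEQ_le_const[OF lim(1)[OF l]] cwz[OF l] by blast
    moreover have "cmod (W l) = 1"
      using LIMSEQ_unique[OF tendsto_norm[OF lim(2)[OF l]], of 1] cwz[OF l] by simp
    moreover have "cmod (Z l) = 1"
      using LIMSEQ_unique[OF tendsto_norm[OF lim(3)[OF l]], of 1] cwz[OF l] by simp
    ultimately show "0 \<le> C l \<and> cmod (W l) = 1 \<and> cmod (Z l) = 1" by simp
  next
    fix g h assume gh: "g < n * m" "h < n * m"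
    have "(\<lambda>k. \<Sum>l<D. complex_of_real (c (r k) l) * V (w (r k) l) (z (r k) l) g h) \<longlonglongrightarrow>
        (\<Sum>l<D. complex_of_real (C l) * V (W l) (Z l) g h)"
      unfolding V_def torus_vec_def by (intro tendsto_intros lim) simp_all
    moreover have "(\<lambda>k. complex_of_real (\<epsilon> (r k)) * 1\<^sub>m (n * m) $$ (g, h) + x $$ (g, h)) \<longlonglongrightarrow>
        complex_of_real 0 * 1\<^sub>m (n * m) $$ (g, h) + x $$ (g, h)"
      using LIMSEQ_subseq_LIMSEQ[OF LIMSEQ_inverse_real_of_nat r]
      by (intro tendsto_intros) (simp add: \<epsilon>_def o_def)
    ultimately have "(\<Sum>l<D. complex_of_real (C l) * V (W l) (Z l) g h) =
        complex_of_real 0 * 1\<^sub>m (n * m) $$ (g, h) + x $$ (g, h)"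
      unfolding x[OF gh] by (rule LIMSEQ_unique)
    thus "x $$ (g, h) = (\<Sum>l\<in>{..<D}. complex_of_real (C l) *
        (torus_vec m (W l) (Z l) g * cnj (torus_vec m (W l) (Z l) h)))"
      by (simp add: V_def)
  qed simp
qed

section \<open>Compressions and the maximal tensor product\<close>

lemma block_index:
  "r < d \<Longrightarrow> s < d \<Longrightarrow> block d A i j $$ (r, s) = A $$ (i * d + r, j * d + s)"
  by (simp add: block_def)

lemma of_blocks_index:
  "i < p \<Longrightarrow> j < p \<Longrightarrow> r < d \<Longrightarrow> s < d \<Longrightarrow> of_blocks p d B $$ (i * d + r, j * d + s) = B i j $$ (r, s)"
  by (simp add: of_blocks_def block_index_less)

lemma compression_index:
  assumes M: "M \<in> carrier_mat (K * D) (K * D)" and \<delta>: "\<delta> \<in> carrier_mat K 1" and gh: "g < D" "h < D"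
  shows "(mat_adjoint (kron \<delta> (1\<^sub>m D)) * M * kron \<delta> (1\<^sub>m D)) $$ (g, h) =
    (\<Sum>u<K. \<Sum>v<K. cnj (\<delta> $$ (u, 0)) * \<delta> $$ (v, 0) * M $$ (u * D + g, v * D + h))"
proof -
  define E where "E = kron \<delta> (1\<^sub>m D)"
  have E: "E \<in> carrier_mat (K * D) D" using \<delta> by (simp add: E_def kron_def)
  have Ei: "E $$ (u * D + r, s) = (if r = s then \<delta> $$ (u, 0) else 0)" if "u < K" "r < D" "s < D" for u r s
    using \<delta> that by (simp add: E_def kron_def block_index_less)
  have EM: "(mat_adjoint E * M) $$ (g, Y) = (\<Sum>u<K. cnj (\<delta> $$ (u, 0)) * M $$ (u * D + g, Y))"
    if "Y < K * D" for Y
  proof -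
    have "(mat_adjoint E * M) $$ (g, Y) = (\<Sum>X<K * D. cnj (E $$ (X, g)) * M $$ (X, Y))"
      using E M that gh by (simp add: scalar_prod_def mat_adjoint_index lessThan_atLeast0)
    also have "\<dots> = (\<Sum>u<K. \<Sum>r<D. if r = g then cnj (\<delta> $$ (u, 0)) * M $$ (u * D + g, Y) else 0)"
      unfolding sum_block_index using gh by (intro sum.cong refl) (simp add: Ei)
    finally show ?thesis using gh by simp
  qed
  have "(mat_adjoint E * M * E) $$ (g, h) = (\<Sum>Y<K * D. (mat_adjoint E * M) $$ (g, Y) * E $$ (Y, h))"
    using E M gh by (simp add: scalar_prod_def lessThan_atLeast0)
  also have "\<dots> = (\<Sum>v<K. \<Sum>r<D. if r = h then (mat_adjoint E * M) $$ (g, v * D + h) * \<delta> $$ (v, 0) else 0)"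
    unfolding sum_block_index using gh by (intro sum.cong refl) (simp add: Ei)
  also have "\<dots> = (\<Sum>v<K. (mat_adjoint E * M) $$ (g, v * D + h) * \<delta> $$ (v, 0))"
    using gh by simp
  also have "\<dots> = (\<Sum>v<K. \<Sum>u<K. cnj (\<delta> $$ (u, 0)) * \<delta> $$ (v, 0) * M $$ (u * D + g, v * D + h))"
  proof (rule sum.cong)
    fix v assume "v \<in> {..<K}"
    hence "v * D + h < K * D" using gh by (simp add: block_index_less)
    from EM[OF this] show "(mat_adjoint E * M) $$ (g, v * D + h) * \<delta> $$ (v, 0) =
        (\<Sum>u<K. cnj (\<delta> $$ (u, 0)) * \<delta> $$ (v, 0) * M $$ (u * D + g, v * D + h))"
      by (simp only: sum_distrib_right) (simp add: mult_ac)
  qed simp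
  also have "\<dots> = (\<Sum>u<K. \<Sum>v<K. cnj (\<delta> $$ (u, 0)) * \<delta> $$ (v, 0) * M $$ (u * D + g, v * D + h))"
    by (rule sum.swap)
  finally show ?thesis by (simp add: E_def)
qed

lemma mat_tensor_index:
  assumes "u < k * q" "v < k * q" "g < n * m" "h < n * m"
  shows "mat_tensor k n q m a b $$ (u * (n * m) + g, v * (n * m) + h) =
    a $$ (u div q * n + g div m, v div q * n + h div m) *
    b $$ (u mod q * m + g mod m, v mod q * m + h mod m)"
  using assms block_index_cases[OF assms(3)] block_index_cases[OF assms(4)]
  unfolding mat_tensor_def
  by (simp add: of_blocks_index) (simp add: kron_def block_def)

text \<open>Decompose \<open>a\<close> and \<open>b\<close> separately. Each pair consisting of a
  node of \<open>a\<close> and a node of \<open>b\<close> is a point of the torus, and summing its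
  coefficients against \<delta> gives a squared modulus, hence a nonnegative mass.\<close>

lemma compression_atomic:
  assumes a: "a \<in> mat_pos_cone k n (toeplitz n)" and b: "b \<in> mat_pos_cone q m (toeplitz m)"
    and \<delta>: "\<delta> \<in> carrier_mat (k * q) 1"
  shows "atomic n m (mat_adjoint (kron \<delta> (1\<^sub>m (n * m))) * mat_tensor k n q m a b * kron \<delta> (1\<^sub>m (n * m)))"
    (is "atomic n m ?x")
proof -
  have a': "psd (k * n) a" "\<And>i j. i < k \<Longrightarrow> j < k \<Longrightarrow> block n a i j \<in> toeplitz n"
    using a by (auto simp: mat_pos_cone_def)
  obtain L :: nat and G w where w: "\<And>l. l < L \<Longrightarrow> cmod (w l) = 1"
    and aG: "\<And>u v i j. u < k \<Longrightarrow> v < k \<Longrightarrow> i < n \<Longrightarrow> j < n \<Longrightarrow>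
      a $$ (u * n + i, v * n + j) = (\<Sum>l<L. G l u * cnj (G l v) * (w l ^ i * cnj (w l) ^ j))"
    by (rule psd_block_toeplitz_decomposition[OF a']) (assumption | rule that)+
  have b': "psd (q * m) b" "\<And>i j. i < q \<Longrightarrow> j < q \<Longrightarrow> block m b i j \<in> toeplitz m"
    using b by (auto simp: mat_pos_cone_def)
  obtain L' :: nat and H z where z: "\<And>l. l < L' \<Longrightarrow> cmod (z l) = 1"
    and bH: "\<And>u v i j. u < q \<Longrightarrow> v < q \<Longrightarrow> i < m \<Longrightarrow> j < m \<Longrightarrow>
      b $$ (u * m + i, v * m + j) = (\<Sum>l<L'. H l u * cnj (H l v) * (z l ^ i * cnj (z l) ^ j))"
    by (rule psd_block_toeplitz_decomposition[OF b']) (assumption | rule that)+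
  define S where "S = {..<L} \<times> {..<L'}"
  \<comment> \<open>The factor depending on the row index \<open>u\<close>; the column index
    \<open>v\<close> contributes its conjugate, so the double sum over \<open>u\<close> and
    \<open>v\<close> is the square \<open>c s\<close>.\<close>
  define P where "P = (\<lambda>s u. cnj (\<delta> $$ (u, 0)) * G (fst s) (u div q) * H (snd s) (u mod q))"
  define c where "c = (\<lambda>s. (cmod (\<Sum>u<k * q. P s u))\<^sup>2)"
  define V where "V = (\<lambda>s g h. torus_vec m (w (fst s)) (z (snd s)) g * cnj (torus_vec m (w (fst s)) (z (snd s)) h))"
  show ?thesis
  proof (rule atomicI[where S = S and c = c and w = "w \<circ> fst" and z = "z \<circ> snd"])
    show "?x \<in> carrier_mat (n * m) (n * m)"
      using \<delta> by (intro carrier_matI) (simp_all add: kron_def)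
    show "finite S" by (simp add: S_def)
    show "0 \<le> c s \<and> cmod ((w \<circ> fst) s) = 1 \<and> cmod ((z \<circ> snd) s) = 1" if "s \<in> S" for s
      using that w z by (auto simp: S_def c_def)
    fix g h assume gh: "g < n * m" "h < n * m"
    note g = block_index_cases[OF gh(1)] and h = block_index_cases[OF gh(2)]
    have entry: "cnj (\<delta> $$ (u, 0)) * \<delta> $$ (v, 0) * mat_tensor k n q m a b $$ (u * (n * m) + g, v * (n * m) + h)
        = (\<Sum>s\<in>S. P s u * cnj (P s v) * V s g h)" if uv: "u < k * q" "v < k * q" for u v
    proof -
      note u = block_index_cases[OF uv(1)] and v = block_index_cases[OF uv(2)]
      have "mat_tensor k n q m a b $$ (u * (n * m) + g, v * (n * m) + h) =
          (\<Sum>l<L. G l (u div q) * cnj (G l (v div q)) * (w l ^ (g div m) * cnj (w l) ^ (h div m))) *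
          (\<Sum>l<L'. H l (u mod q) * cnj (H l (v mod q)) * (z l ^ (g mod m) * cnj (z l) ^ (h mod m)))"
        using g h u v by (simp add: mat_tensor_index uv gh aG bH)
      also have "\<dots> = (\<Sum>s\<in>S. (G (fst s) (u div q) * cnj (G (fst s) (v div q)) * (w (fst s) ^ (g div m) * cnj (w (fst s)) ^ (h div m))) *
          (H (snd s) (u mod q) * cnj (H (snd s) (v mod q)) * (z (snd s) ^ (g mod m) * cnj (z (snd s)) ^ (h mod m))))"
        unfolding sum_product S_def by (simp add: sum.cartesian_product case_prod_unfold)
      finally show ?thesis
        by (simp only: sum_distrib_left) (simp add: P_def V_def torus_vec_def ac_simps)
    qed
    have "mat_tensor k n q m a b \<in> carrier_mat (k * q * (n * m)) (k * q * (n * m))"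
      by (simp add: mat_tensor_def of_blocks_def)
    from compression_index[OF this \<delta> gh]
    have "?x $$ (g, h) = (\<Sum>u<k * q. \<Sum>v<k * q. \<Sum>s\<in>S. P s u * cnj (P s v) * V s g h)"
      by (simp add: entry)
    also have "\<dots> = (\<Sum>u<k * q. \<Sum>s\<in>S. \<Sum>v<k * q. P s u * cnj (P s v) * V s g h)"
      by (intro sum.cong refl sum.swap)
    also have "\<dots> = (\<Sum>s\<in>S. \<Sum>u<k * q. \<Sum>v<k * q. P s u * cnj (P s v) * V s g h)"
      by (rule sum.swap)
    also have "\<dots> = (\<Sum>s\<in>S. complex_of_real (c s) * V s g h)"
      unfolding c_def complex_norm_square cnj_sum sum_product by (simp only: sum_distrib_right)
    finally show "?x $$ (g, h) = (\<Sum>s\<in>S. complex_of_real (c s) *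
        (torus_vec m ((w \<circ> fst) s) ((z \<circ> snd) s) g * cnj (torus_vec m ((w \<circ> fst) s) ((z \<circ> snd) s) h)))"
      by (simp add: V_def)
  qed
qed

lemma kron_one: "kron (1\<^sub>m n) (1\<^sub>m m) = 1\<^sub>m (n * m)"
proof (rule eq_matI)
  fix g h assume "g < dim_row (1\<^sub>m (n * m))" "h < dim_col (1\<^sub>m (n * m))"
  hence gh: "g < n * m" "h < n * m" by simp_all
  note g = block_index_cases[OF gh(1)] and h = block_index_cases[OF gh(2)]
  have "(g div m = h div m \<and> g mod m = h mod m) = (g = h)" using g(3) h(3) by metis
  thus "kron (1\<^sub>m n) (1\<^sub>m m) $$ (g, h) = 1\<^sub>m (n * m) $$ (g, h)"
    using gh g h by (auto simp: kron_def)
qed (simp_all add: kron_def)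

lemma max_cone_imp_atomic:
  assumes "n > 0" "m > 0" and x: "x \<in> max_cone n (toeplitz n) m (toeplitz m)"
  shows "atomic n m x"
proof (rule atomic_closed)
  show "x \<in> carrier_mat (n * m) (n * m)"
    using x by (auto simp: max_cone_def tensor_def sum_kron_def)
  fix \<epsilon> :: real assume "\<epsilon> > 0"
  then obtain k q a b \<delta> where "a \<in> mat_pos_cone k n (toeplitz n)" "b \<in> mat_pos_cone q m (toeplitz m)"
    "\<delta> \<in> carrier_mat (k * q) 1" and eq: "complex_of_real \<epsilon> \<cdot>\<^sub>m kron (1\<^sub>m n) (1\<^sub>m m) + x =
      mat_adjoint (kron \<delta> (1\<^sub>m (n * m))) * mat_tensor k n q m a b * kron \<delta> (1\<^sub>m (n * m))"
    using x unfolding max_cone_def by blast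
  thus "atomic n m (complex_of_real \<epsilon> \<cdot>\<^sub>m 1\<^sub>m (n * m) + x)"
    unfolding eq[unfolded kron_one] by (intro compression_atomic)
qed fact+

subsection \<open>The separability cone\<close>

lemma sep_cone_subset_tensor: "sep_cone n R m T \<subseteq> tensor n R m T"
  unfolding sep_cone_def tensor_def pos_cone_def by blast

definition block_diag :: "nat \<Rightarrow> nat \<Rightarrow> (nat \<Rightarrow> complex mat) \<Rightarrow> complex mat" where
  "block_diag k n a = of_blocks k n (\<lambda>i j. if i = j then a i else 0\<^sub>m n n)"

lemma block_diag_index:
  assumes "\<And>i. i < k \<Longrightarrow> a i \<in> carrier_mat n n" "i < k" "j < k" "r < n" "s < n"
  shows "block_diag k n a $$ (i * n + r, j * n + s) = (if i = j then a i $$ (r, s) else 0)"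
  using assms by (simp add: block_diag_def of_blocks_index)

lemma block_diag_mat_pos_cone:
  assumes R: "op_system n R" and a: "\<And>i. i < k \<Longrightarrow> a i \<in> pos_cone n R"
  shows "block_diag k n a \<in> mat_pos_cone k n R"
proof -
  have car: "a i \<in> carrier_mat n n" and psd: "psd n (a i)" and aR: "a i \<in> R" if "i < k" for i
    using a[OF that] by (auto simp: pos_cone_def psd_carrier)
  note index = block_diag_index[of k a n, OF car]
  have z: "0\<^sub>m n n \<in> R"
  proof -
    have "0 \<cdot>\<^sub>m 1\<^sub>m n \<in> R" using R by (simp add: op_system_def)
    moreover have "0 \<cdot>\<^sub>m 1\<^sub>m n = (0\<^sub>m n n :: complex mat)" by (rule eq_matI) auto
    ultimately show ?thesis by simp
  qed
  have "block n (block_diag k n a) i j = (if i = j then a i else 0\<^sub>m n n)" if "i < k" "j < k" for i j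
    using that car[OF that(1)] by (intro eq_matI) (auto simp: block_index index block_def)
  hence blocks: "block n (block_diag k n a) i j \<in> R" if "i < k" "j < k" for i j
    using that z aR by simp
  have "quad_form (k * n) (block_diag k n a) x x =
      (\<Sum>i<k. quad_form n (a i) (\<lambda>r. x (i * n + r)) (\<lambda>r. x (i * n + r)))" for x
  proof -
    have "(\<Sum>j<k. \<Sum>s<n. block_diag k n a $$ (i * n + r, j * n + s) * x (j * n + s) * cnj (x (i * n + r))) =
        (\<Sum>s<n. a i $$ (r, s) * x (i * n + s) * cnj (x (i * n + r)))" if "i < k" "r < n" for i r
    proof -
      have "(\<Sum>j<k. \<Sum>s<n. block_diag k n a $$ (i * n + r, j * n + s) * x (j * n + s) * cnj (x (i * n + r))) =
          (\<Sum>j<k. if j = i then \<Sum>s<n. a i $$ (r, s) * x (i * n + s) * cnj (x (i * n + r)) else 0)"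
        using that by (intro sum.cong refl) (auto simp: index)
      thus ?thesis using that by simp
    qed
    thus ?thesis by (simp add: quad_form_def sum_block_index)
  qed
  hence "psd (k * n) (block_diag k n a)"
    using psd by (auto simp: psd_iff_quad_form block_diag_def of_blocks_def intro!: sum_nonneg)
  thus ?thesis using blocks by (simp add: mat_pos_cone_def psd_carrier)
qed

lemma scaled_one_pos_cone:
  assumes "op_system n R" "c \<ge> 0"
  shows "complex_of_real c \<cdot>\<^sub>m 1\<^sub>m n \<in> pos_cone n R"
proof -
  let ?e = "\<lambda>l i. if i = l then complex_of_real (sqrt c) else 0"
  have "psd n (complex_of_real c \<cdot>\<^sub>m 1\<^sub>m n)"
  proof (rule psd_sum_rank_one[where S = "{..<n}" and g = ?e])
    fix i j assume "i < n" "j < n"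
    have "(\<Sum>l<n. ?e l i * cnj (?e l j)) = (\<Sum>l<n. if l = i then if i = j then complex_of_real c else 0 else 0)"
      using assms(2) by (intro sum.cong) (auto simp flip: of_real_mult)
    thus "(complex_of_real c \<cdot>\<^sub>m 1\<^sub>m n) $$ (i, j) = (\<Sum>l<n. ?e l i * cnj (?e l j))"
      using \<open>i < n\<close> \<open>j < n\<close> by simp
  qed simp
  thus ?thesis using assms(1) by (auto simp: pos_cone_def op_system_def)
qed

text \<open>Put the \<open>a j\<close> and the \<open>b j\<close> on the diagonals of two block
  matrices of the same size. The vector \<delta>, the sum of all \<open>e_j \<otimes> e_j\<close>,
  picks out exactly the products with equal indices.\<close>

lemma sep_cone_subset_max_cone:
  assumes R: "op_system n R" and T: "op_system m T"
  shows "sep_cone n R m T \<subseteq> max_cone n R m T"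
proof
  fix x assume x: "x \<in> sep_cone n R m T"
  then obtain l a b where ab: "\<And>j. j < l \<Longrightarrow> a j \<in> pos_cone n R \<and> b j \<in> pos_cone m T"
    and xs: "x = sum_kron (n * m) l a b" unfolding sep_cone_def by blast
  have "\<exists>k \<ge> 1. \<exists>q \<ge> 1. \<exists>A \<in> mat_pos_cone k n R. \<exists>B \<in> mat_pos_cone q m T. \<exists>\<delta> \<in> carrier_mat (k * q) 1.
      complex_of_real \<epsilon> \<cdot>\<^sub>m kron (1\<^sub>m n) (1\<^sub>m m) + x =
        mat_adjoint (kron \<delta> (1\<^sub>m (n * m))) * mat_tensor k n q m A B * kron \<delta> (1\<^sub>m (n * m))"
    if "\<epsilon> > 0" for \<epsilon>
  proof -
    \<comment> \<open>One additional diagonal place, with index \<open>l\<close>, carries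
      \<open>\<epsilon> 1 \<otimes> 1\<close>; it also makes \<open>k\<close> positive when the sum
      is empty.\<close>
    define k where "k = Suc l"
    define a' where "a' = (\<lambda>j. if j < l then a j else complex_of_real \<epsilon> \<cdot>\<^sub>m 1\<^sub>m n)"
    define b' where "b' = (\<lambda>j. if j < l then b j else complex_of_real 1 \<cdot>\<^sub>m 1\<^sub>m m)"
    have a': "a' j \<in> pos_cone n R" and b': "b' j \<in> pos_cone m T" for j
      using ab[of j] scaled_one_pos_cone[OF R, of \<epsilon>] scaled_one_pos_cone[OF T, of 1] that
      by (simp_all add: a'_def b'_def)
    have car: "a' j \<in> carrier_mat n n" "b' j \<in> carrier_mat m m" for j
      using a' b' by (auto simp: pos_cone_def psd_carrier)
    define A where "A = block_diag k n a'"
    define B where "B = block_diag k m b'"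
    have AB: "A \<in> mat_pos_cone k n R" "B \<in> mat_pos_cone k m T"
      unfolding A_def B_def using a' b' by (simp_all add: block_diag_mat_pos_cone[OF R] block_diag_mat_pos_cone[OF T])
    define \<delta> where "\<delta> = mat (k * k) 1 (\<lambda>(u, _). if u div k = u mod k then 1 else 0 :: complex)"
    have \<delta>: "\<delta> \<in> carrier_mat (k * k) 1" by (simp add: \<delta>_def)
    let ?M = "mat_tensor k n k m A B"
    have M: "?M \<in> carrier_mat (k * k * (n * m)) (k * k * (n * m))"
      by (simp add: mat_tensor_def of_blocks_def)
    have "complex_of_real \<epsilon> \<cdot>\<^sub>m kron (1\<^sub>m n) (1\<^sub>m m) + x =
        mat_adjoint (kron \<delta> (1\<^sub>m (n * m))) * ?M * kron \<delta> (1\<^sub>m (n * m))" (is "?L = ?R")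
    proof (rule eq_matI)
      show "dim_row ?L = dim_row ?R" "dim_col ?L = dim_col ?R"
        by (simp_all add: xs sum_kron_def kron_def \<delta>_def)
      fix g h assume "g < dim_row ?R" "h < dim_col ?R"
      hence gh: "g < n * m" "h < n * m" by (simp_all add: kron_def \<delta>_def)
      note g = block_index_cases[OF gh(1)] and h = block_index_cases[OF gh(2)]
      have \<delta>u: "\<delta> $$ (i * k + i', 0) = (if i = i' then 1 else 0)" if "i < k" "i' < k" for i i'
        using that by (simp add: \<delta>_def block_index_less)
      have Mi: "?M $$ ((i * k + i) * (n * m) + g, (j * k + j) * (n * m) + h) =
          (if i = j then a' i $$ (g div m, h div m) * b' i $$ (g mod m, h mod m) else 0)"
        if "i < k" "j < k" for i j
        using that g h by (simp add: mat_tensor_index gh block_index_less A_def B_def block_diag_index car)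
      have "?R $$ (g, h) = (\<Sum>u<k * k. \<Sum>v<k * k. cnj (\<delta> $$ (u, 0)) * \<delta> $$ (v, 0) * ?M $$ (u * (n * m) + g, v * (n * m) + h))"
        by (rule compression_index[OF M \<delta> gh])
      also have "\<dots> = (\<Sum>i<k. \<Sum>i'<k. if i' = i then
          (\<Sum>v<k * k. \<delta> $$ (v, 0) * ?M $$ ((i * k + i) * (n * m) + g, v * (n * m) + h)) else 0)"
        unfolding sum_block_index[of _ k k] by (intro sum.cong refl) (auto simp: \<delta>u)
      also have "\<dots> = (\<Sum>i<k. \<Sum>v<k * k. \<delta> $$ (v, 0) * ?M $$ ((i * k + i) * (n * m) + g, v * (n * m) + h))"
        by simp
      also have "\<dots> = (\<Sum>i<k. \<Sum>j<k. \<Sum>j'<k. if j' = j then ?M $$ ((i * k + i) * (n * m) + g, (j * k + j) * (n * m) + h) else 0)"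
        unfolding sum_block_index[of _ k k] by (intro sum.cong refl) (auto simp: \<delta>u)
      also have "\<dots> = (\<Sum>i<k. \<Sum>j<k. if j = i then a' i $$ (g div m, h div m) * b' i $$ (g mod m, h mod m) else 0)"
        by (intro sum.cong refl) (auto simp: Mi)
      also have "\<dots> = (\<Sum>i<k. a' i $$ (g div m, h div m) * b' i $$ (g mod m, h mod m))" by simp
      also have "\<dots> = (\<Sum>i<l. a i $$ (g div m, h div m) * b i $$ (g mod m, h mod m)) +
          complex_of_real \<epsilon> * (1\<^sub>m n $$ (g div m, h div m) * 1\<^sub>m m $$ (g mod m, h mod m))"
        using g h by (simp add: k_def a'_def b'_def)
      also have "(\<Sum>i<l. a i $$ (g div m, h div m) * b i $$ (g mod m, h mod m)) = x $$ (g, h)"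
      proof -
        have "\<forall>j<l. a j \<in> carrier_mat n n \<and> b j \<in> carrier_mat m m"
          using ab by (auto simp: pos_cone_def psd_carrier)
        from sum_kron_index[OF this g(1) h(1) g(2) h(2)] show ?thesis by (simp add: xs)
      qed
      also have "1\<^sub>m n $$ (g div m, h div m) * 1\<^sub>m m $$ (g mod m, h mod m) = kron (1\<^sub>m n) (1\<^sub>m m) $$ (g, h)"
        using gh by (simp add: kron_def)
      finally show "?L $$ (g, h) = ?R $$ (g, h)"
        using gh by (simp add: xs sum_kron_def kron_def)
    qed
    thus ?thesis using AB \<delta> by (intro exI[of _ k] conjI bexI[of _ A] bexI[of _ B] bexI[of _ \<delta>]) (auto simp: k_def)
  qed
  thus "x \<in> max_cone n R m T"
    using subsetD[OF sep_cone_subset_tensor x] by (simp add: max_cone_def)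
qed

section \<open>Completely positive maps and the minimal tensor product\<close>

lemma ucp_psd:
  assumes R: "op_system n R" and \<phi>: "ucp n R k \<phi>" and a: "a \<in> pos_cone n R"
  shows "psd k (\<phi> a)"
proof -
  have car: "a \<in> carrier_mat n n" "\<phi> a \<in> carrier_mat k k"
    using a \<phi> by (auto simp: pos_cone_def psd_carrier ucp_def)
  have "block n a 0 0 = a" using car by (intro eq_matI) (auto simp: block_def)
  moreover from this have "a \<in> mat_pos_cone 1 n R"
    using a car by (auto simp: mat_pos_cone_def pos_cone_def)
  hence "psd (1 * k) (of_blocks 1 k (\<lambda>i j. \<phi> (block n a i j)))"
    using \<phi> unfolding ucp_def by blast
  moreover have "of_blocks 1 k (\<lambda>i j. \<phi> (block n a i j)) = \<phi> (block n a 0 0)"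
    using car calculation(1) by (intro eq_matI) (auto simp: of_blocks_def)
  ultimately show ?thesis by simp
qed

lemma sep_cone_subset_min_cone:
  assumes R: "op_system n R" and T: "op_system m T"
  shows "sep_cone n R m T \<subseteq> min_cone n R m T"
proof
  fix x assume x: "x \<in> sep_cone n R m T"
  then obtain l a b where ab: "\<And>j. j < l \<Longrightarrow> a j \<in> pos_cone n R \<and> b j \<in> pos_cone m T"
    and xs: "x = sum_kron (n * m) l a b" unfolding sep_cone_def by blast
  have "psd (k * q) (tensor_map n R k \<phi> m T q \<psi> x)"
    if "ucp n R k \<phi>" "ucp m T q \<psi>" for k q \<phi> \<psi>
  proof -
    have "tensor_map n R k \<phi> m T q \<psi> x = sum_kron (k * q) l (\<lambda>j. \<phi> (a j)) (\<lambda>j. \<psi> (b j))"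
      unfolding xs by (rule tensor_map_sum_kron[OF R T that]) (use ab in \<open>simp add: pos_cone_def\<close>)
    thus ?thesis using ab by (simp add: psd_sum_kron ucp_psd[OF R that(1)] ucp_psd[OF T that(2)])
  qed
  thus "x \<in> min_cone n R m T"
    using subsetD[OF sep_cone_subset_tensor x] by (simp add: min_cone_def)
qed

lemma ucp_id:
  assumes "op_system n R"
  shows "ucp n R n (\<lambda>a. a)"
proof -
  have "of_blocks p n (block n A) = A" if "A \<in> carrier_mat (p * n) (p * n)" for p A
  proof (rule eq_matI)
    fix g h assume "g < dim_row A" "h < dim_col A"
    hence gh: "g < p * n" "h < p * n" using that by auto
    show "of_blocks p n (block n A) $$ (g, h) = A $$ (g, h)"
      using block_index_cases[OF gh(1)] block_index_cases[OF gh(2)] gh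
      by (simp add: of_blocks_def block_def)
  qed (use that in \<open>auto simp: of_blocks_def\<close>)
  thus ?thesis using assms by (auto simp: ucp_def op_system_def mat_pos_cone_def)
qed

text \<open>Test minimal positivity with the two inclusions into the full matrix algebras; their
  tensor product leaves \<open>x\<close> unchanged.\<close>

lemma min_cone_imp_psd:
  assumes R: "op_system n R" and T: "op_system m T" and "n > 0" "m > 0" and x: "x \<in> min_cone n R m T"
  shows "psd (n * m) x"
proof -
  have "psd (n * m) (tensor_map n R n (\<lambda>a. a) m T m (\<lambda>b. b) x)"
    using assms ucp_id[OF R] ucp_id[OF T] by (auto simp: min_cone_def)
  moreover obtain l a b where "\<forall>j<l. a j \<in> R \<and> b j \<in> T" "x = sum_kron (n * m) l a b"
    using x by (auto simp: min_cone_def tensor_def)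
  ultimately show ?thesis using tensor_map_sum_kron[OF R T ucp_id[OF R] ucp_id[OF T]] by simp
qed

text \<open>Replacing each \<open>2 \<times> 2\<close> coefficient \<open>g g\<^sup>*\<close> by its average with its flip along the
  antidiagonal makes it a Toeplitz matrix and does not change \<open>x\<close>.\<close>
lemma psd_2_toeplitz_atomic:
  assumes psd: "psd (2 * m) x" and toep: "\<And>i j. i < 2 \<Longrightarrow> j < 2 \<Longrightarrow> block m x i j \<in> toeplitz m"
    and diag: "block m x 1 1 = block m x 0 0"
  shows "atomic 2 m x"
proof -
  obtain L :: nat and G z where z: "\<And>l. l < L \<Longrightarrow> cmod (z l) = 1"
    and xG: "\<And>i j r s. i < 2 \<Longrightarrow> j < 2 \<Longrightarrow> r < m \<Longrightarrow> s < m \<Longrightarrow>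
      x $$ (i * m + r, j * m + s) = (\<Sum>l<L. G l i * cnj (G l j) * (z l ^ r * cnj (z l) ^ s))"
    using psd toep by (rule psd_block_toeplitz_decomposition) (assumption | rule that)+
  define Q where "Q = (\<lambda>l i j. (G l i * cnj (G l j) + G l (1 - j) * cnj (G l (1 - i))) / 2)"
  have xQ: "x $$ (i * m + r, j * m + s) = (\<Sum>l<L. Q l i j * (z l ^ r * cnj (z l) ^ s))"
    if ij: "i < 2" "j < 2" and rs: "r < m" "s < m" for i j r s
  proof -
    have eq: "x $$ (0 * m + r, 0 * m + s) = x $$ (1 * m + r, 1 * m + s)"
      using arg_cong[OF diag, of "\<lambda>M. M $$ (r, s)"] rs by (simp add: block_def)
    \<comment> \<open>The flip \<open>(i, j) \<mapsto> (1 - j, 1 - i)\<close> fixes the off-diagonal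
      positions and exchanges the diagonal ones, where the two blocks of \<open>x\<close> agree by
      \<open>diag\<close>.\<close>
    have "1 - j = i \<and> 1 - i = j \<or> i = 0 \<and> j = 0 \<or> i = 1 \<and> j = 1" using ij by arith
    hence "x $$ ((1 - j) * m + r, (1 - i) * m + s) = x $$ (i * m + r, j * m + s)"
      by (elim disjE conjE) (simp_all only: eq diff_zero diff_self_eq_0)
    hence "x $$ (i * m + r, j * m + s) = (x $$ (i * m + r, j * m + s) + x $$ ((1 - j) * m + r, (1 - i) * m + s)) / 2"
      by simp
    also have "\<dots> = ((\<Sum>l<L. G l i * cnj (G l j) * (z l ^ r * cnj (z l) ^ s)) +
        (\<Sum>l<L. G l (1 - j) * cnj (G l (1 - i)) * (z l ^ r * cnj (z l) ^ s))) / 2"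
    proof -
      have "x $$ (i * m + r, j * m + s) = (\<Sum>l<L. G l i * cnj (G l j) * (z l ^ r * cnj (z l) ^ s))"
        by (rule xG) fact+
      moreover have "x $$ ((1 - j) * m + r, (1 - i) * m + s) =
          (\<Sum>l<L. G l (1 - j) * cnj (G l (1 - i)) * (z l ^ r * cnj (z l) ^ s))"
        by (rule xG) (use rs in auto)
      ultimately show ?thesis by (simp only:)
    qed
    also have "\<dots> = (\<Sum>l<L. Q l i j * (z l ^ r * cnj (z l) ^ s))"
      unfolding Q_def sum.distrib[symmetric] sum_divide_distrib by (simp add: distrib_right)
    finally show ?thesis .
  qed
  define P where "P = (\<lambda>l. mat 2 2 (\<lambda>(i, j). Q l i j))"
  define dec where "dec = (\<lambda>l (M :: nat) H w. (\<forall>s<M. cmod (w s) = 1) \<and> (\<forall>i<2. \<forall>j<2. Q l i j =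
      (\<Sum>s<M. complex_of_real ((cmod (H s))\<^sup>2) * (w s ^ i * cnj (w s) ^ j))))"
  have "\<exists>M H w. dec l M H w" for l
  proof -
    \<comment> \<open>The flip of \<open>g g*\<close> is again of rank one, given by the vector with
      entries \<open>cnj (g (1 - i))\<close>.\<close>
    have "psd 2 (P l)"
    proof (rule psd_sum_rank_one[where S = "{0, 1 :: nat}"
          and g = "\<lambda>t i. (if t = 0 then G l i else cnj (G l (1 - i))) / complex_of_real (sqrt 2)"])
      fix i j :: nat assume "i < 2" "j < 2"
      moreover have "complex_of_real (sqrt 2) * complex_of_real (sqrt 2) = 2" by (simp flip: of_real_mult)
      ultimately show "P l $$ (i, j) = (\<Sum>t\<in>{0, 1 :: nat}.
          (if t = 0 then G l i else cnj (G l (1 - i))) / complex_of_real (sqrt 2) *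
          cnj ((if t = 0 then G l j else cnj (G l (1 - j))) / complex_of_real (sqrt 2)))"
        by (simp add: P_def Q_def add_divide_distrib mult.commute)
    qed (simp add: P_def)
    \<comment> \<open>Seen as a single Toeplitz block, \<open>P l\<close> decomposes with scalar
      coefficients \<open>H s 0 * cnj (H s 0)\<close>, which are masses on the circle.\<close>
    hence psdP: "psd (1 * 2) (P l)" by simp
    have "Q l (Suc 0) (Suc 0) = Q l 0 0" by (simp add: Q_def add.commute)
    hence "P l = mat 2 2 (\<lambda>(i, j). (\<lambda>d. if d = 0 then Q l 0 0 else if d > 0 then Q l 1 0 else Q l 0 1) (int i - int j))"
      by (intro eq_matI) (auto simp: P_def less_2_cases_iff)
    hence "P l \<in> toeplitz 2" by (rule toeplitzI)
    moreover have "block 2 (P l) 0 0 = P l" by (rule eq_matI) (simp_all add: block_def P_def)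
    ultimately have toepP: "block 2 (P l) a b \<in> toeplitz 2" if "a < 1" "b < 1" for a b
      using that by simp
    obtain M :: nat and H w where w: "\<And>s. s < M \<Longrightarrow> cmod (w s) = 1"
      and PH: "\<And>a b i j. a < 1 \<Longrightarrow> b < 1 \<Longrightarrow> i < 2 \<Longrightarrow> j < 2 \<Longrightarrow>
        P l $$ (a * 2 + i, b * 2 + j) = (\<Sum>s<M. H s a * cnj (H s b) * (w s ^ i * cnj (w s) ^ j))"
      by (rule psd_block_toeplitz_decomposition[OF psdP toepP]) (assumption | rule that)+
    have "Q l i j = (\<Sum>s<M. complex_of_real ((cmod (H s 0))\<^sup>2) * (w s ^ i * cnj (w s) ^ j))"
      if "i < 2" "j < 2" for i j
      using PH[of 0 0 i j] that unfolding complex_norm_square by (simp add: P_def)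
    thus ?thesis using w by (intro exI[of _ M] exI[of _ "\<lambda>s. H s 0"] exI[of _ w]) (simp add: dec_def)
  qed
  then obtain M H w where "\<And>l. dec l (M l) (H l) (w l)" by metis
  hence w: "\<And>s. s < M l \<Longrightarrow> cmod (w l s) = 1"
    and QH: "\<And>i j. i < 2 \<Longrightarrow> j < 2 \<Longrightarrow>
      Q l i j = (\<Sum>s<M l. complex_of_real ((cmod (H l s))\<^sup>2) * (w l s ^ i * cnj (w l s) ^ j))" for l
    by (auto simp: dec_def)
  show ?thesis
  proof (rule atomicI[where S = "Sigma {..<L} (\<lambda>l. {..<M l})" and c = "\<lambda>(l, s). (cmod (H l s))\<^sup>2"
        and w = "\<lambda>(l, s). w l s" and z = "\<lambda>(l, s). z l"])
    fix g h assume gh: "g < 2 * m" "h < 2 * m"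
    note g = block_index_cases[OF gh(1)] and h = block_index_cases[OF gh(2)]
    have "x $$ (g, h) = (\<Sum>l<L. Q l (g div m) (h div m) * (z l ^ (g mod m) * cnj (z l) ^ (h mod m)))"
      using xQ[OF g(1) h(1) g(2) h(2)] by simp
    also have "\<dots> = (\<Sum>l<L. \<Sum>s<M l. complex_of_real ((cmod (H l s))\<^sup>2) *
        (torus_vec m (w l s) (z l) g * cnj (torus_vec m (w l s) (z l) h)))"
      unfolding QH[OF g(1) h(1)] sum_distrib_right by (simp add: torus_vec_def mult_ac)
    finally show "x $$ (g, h) = (\<Sum>t\<in>Sigma {..<L} (\<lambda>l. {..<M l}).
        complex_of_real (case t of (l, s) \<Rightarrow> (cmod (H l s))\<^sup>2) *
        (torus_vec m (case t of (l, s) \<Rightarrow> w l s) (case t of (l, s) \<Rightarrow> z l) g *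
         cnj (torus_vec m (case t of (l, s) \<Rightarrow> w l s) (case t of (l, s) \<Rightarrow> z l) h)))"
      by (simp add: sum.Sigma case_prod_unfold)
  qed (use psd_carrier[OF psd] w z in auto)
qed

section \<open>First factor of size two and the extension problem\<close>

lemma tensor_block:
  assumes R: "op_system n R" and T: "op_system m T"
    and x: "x = sum_kron (n * m) l a b" and ab: "\<forall>j<l. a j \<in> R \<and> b j \<in> T" and ij: "i < n" "i' < n"
  shows "block m x i i' = mat m m (\<lambda>rs. \<Sum>j<l. a j $$ (i, i') * b j $$ rs)"
proof -
  have "\<forall>j<l. a j \<in> carrier_mat n n \<and> b j \<in> carrier_mat m m"
    using ab R T by (auto simp: op_system_def)
  from sum_kron_index[OF this ij] show ?thesis
    by (intro eq_matI) (auto simp: block_def x)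
qed

lemma min_cone_2_imp_atomic:
  assumes m: "m > 0" and x: "x \<in> min_cone 2 (toeplitz 2) m (toeplitz m)"
  shows "atomic 2 m x"
proof (rule psd_2_toeplitz_atomic)
  show "psd (2 * m) x"
    by (rule min_cone_imp_psd[OF op_system_toeplitz op_system_toeplitz _ m x]) simp
  obtain l a b where ab: "\<forall>j<l. a j \<in> toeplitz 2 \<and> b j \<in> toeplitz m" and xs: "x = sum_kron (2 * m) l a b"
    using x by (auto simp: min_cone_def tensor_def)
  note block = tensor_block[OF op_system_toeplitz op_system_toeplitz xs ab]
  show "block m x i j \<in> toeplitz m" if "i < 2" "j < 2" for i j
  proof -
    have "\<forall>j<l. b j \<in> toeplitz m" using ab by blast
    \<comment> \<open>For the identity map, the first conjunct of \<open>op_system_lincomb\<close>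
      is closure of the system under linear combinations.\<close>
    from op_system_lincomb[OF op_system_toeplitz ucp_id[OF op_system_toeplitz] this, of "\<lambda>k. a k $$ (i, j)"]
    show ?thesis unfolding block[OF that] by (rule conjunct1)
  qed
  have "a j $$ (1, 1) = a j $$ (0, 0)" if "j < l" for j
    using ab that by (auto simp: toeplitz_def)
  thus "block m x 1 1 = block m x 0 0" by (simp add: block)
qed

text \<open>\<open>X k\<close> collects the moments of order \<open>k\<close> in the first variable.
  The block Toeplitz matrix of any size is then the moment matrix of the same measure, so one
  sequence serves every \<open>N\<close>.\<close>

lemma atomic_extension:
  assumes "atomic 2 m x"
  obtains X :: "nat \<Rightarrow> complex mat" where "X 0 = block m x 0 0" "X 1 = block m x 1 0"
    "\<And>j. X j \<in> toeplitz m" "\<And>N. psd (N * m) (block_toeplitz N m X)"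
proof -
  from assms obtain L c w z where
    cwz: "\<And>l. l < (L::nat) \<Longrightarrow> 0 \<le> c l \<and> cmod (w l) = 1 \<and> cmod (z l) = 1"
    and x: "\<And>g h. g < 2 * m \<Longrightarrow> h < 2 * m \<Longrightarrow> x $$ (g, h) =
      (\<Sum>l<L. complex_of_real (c l) * (torus_vec m (w l) (z l) g * cnj (torus_vec m (w l) (z l) h)))"
    unfolding atomic_def by blast
  define X where "X = (\<lambda>k. mat m m (\<lambda>(r, s). \<Sum>l<L. complex_of_real (c l) * w l ^ k * (z l ^ r * cnj (z l) ^ s)))"
  show ?thesis
  proof (rule that)
    show "X 0 = block m x 0 0" "X 1 = block m x 1 0"
      by (auto intro!: eq_matI simp: X_def block_def x torus_vec_def ac_simps)
    show "X j \<in> toeplitz m" for j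
    proof (rule toeplitzI)
      show "X j = mat m m (\<lambda>(r, s). (\<lambda>d. \<Sum>l<L. complex_of_real (c l) * w l ^ j *
          (if d \<ge> 0 then z l ^ nat d else cnj (z l) ^ nat (- d))) (int r - int s))"
        unfolding X_def
        by (rule eq_matI) (auto intro!: sum.cong simp: cwz unimodular_power nat_diff_distrib')
    qed
    show "psd (N * m) (block_toeplitz N m X)" for N
    proof (rule psd_sum_rank_one[where S = "{..<L}" and g = "\<lambda>l g. complex_of_real (sqrt (c l)) * torus_vec m (w l) (z l) g"])
      show "block_toeplitz N m X \<in> carrier_mat (N * m) (N * m)"
        by (simp add: block_toeplitz_def of_blocks_def)
      fix g h assume gh: "g < N * m" "h < N * m"
      note g = block_index_cases[OF gh(1)] and h = block_index_cases[OF gh(2)]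
      have "block_toeplitz N m X $$ (g, h) = (if h div m \<le> g div m then X (g div m - h div m) $$ (g mod m, h mod m)
          else cnj (X (h div m - g div m) $$ (h mod m, g mod m)))"
        using gh g h by (simp add: block_toeplitz_def of_blocks_def mat_adjoint_index X_def)
      also have "\<dots> = (\<Sum>l<L. complex_of_real (c l) *
          (w l ^ (g div m) * cnj (w l) ^ (h div m)) * (z l ^ (g mod m) * cnj (z l) ^ (h mod m)))"
        using g h by (auto intro!: sum.cong simp: X_def cwz unimodular_power[of "w _"])
      also have "\<dots> = (\<Sum>l<L. complex_of_real (sqrt (c l)) * torus_vec m (w l) (z l) g *
          cnj (complex_of_real (sqrt (c l)) * torus_vec m (w l) (z l) h))"
      proof (rule sum.cong)
        fix l assume "l \<in> {..<L}"
        hence "complex_of_real (c l) = complex_of_real (sqrt (c l)) * complex_of_real (sqrt (c l))"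
          using cwz by (simp flip: of_real_mult)
        thus "complex_of_real (c l) * (w l ^ (g div m) * cnj (w l) ^ (h div m)) * (z l ^ (g mod m) * cnj (z l) ^ (h mod m)) =
          complex_of_real (sqrt (c l)) * torus_vec m (w l) (z l) g * cnj (complex_of_real (sqrt (c l)) * torus_vec m (w l) (z l) h)"
          by (simp only:) (simp add: torus_vec_def)
      qed simp
      finally show "block_toeplitz N m X $$ (g, h) = \<dots>" .
    qed
  qed
qed

theorem theorem1p7:
  fixes n m :: nat
  assumes "n \<ge> 2" and "m \<ge> 2"
  shows "max_cone n (toeplitz n) m (toeplitz m) = sep_cone n (toeplitz n) m (toeplitz m) \<and>
         min_cone 2 (toeplitz 2) m (toeplitz m) = sep_cone 2 (toeplitz 2) m (toeplitz m) \<and>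
         (\<forall>x0 \<in> toeplitz m. \<forall>x1 \<in> toeplitz m.
           psd (2 * m) (four_block_mat x0 (mat_adjoint x1) x1 x0) \<longrightarrow>
           (\<forall>N \<ge> 3. \<exists>x :: nat \<Rightarrow> complex mat. x 0 = x0 \<and> x 1 = x1 \<and>
              (\<forall>j \<in> {2..<N}. x j \<in> toeplitz m) \<and> psd (N * m) (block_toeplitz N m x)))"
proof (intro conjI ballI impI allI)
  note sys = op_system_toeplitz
  show "max_cone n (toeplitz n) m (toeplitz m) = sep_cone n (toeplitz n) m (toeplitz m)"
    using sep_cone_subset_max_cone[OF sys sys] assms
    by (intro equalityI subsetI atomic_imp_sep_cone max_cone_imp_atomic) auto
  show "min_cone 2 (toeplitz 2) m (toeplitz m) = sep_cone 2 (toeplitz 2) m (toeplitz m)"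
    using sep_cone_subset_min_cone[OF sys sys] assms
    by (intro equalityI subsetI atomic_imp_sep_cone min_cone_2_imp_atomic) auto
  fix x0 x1 and N :: nat
  assume x: "x0 \<in> toeplitz m" "x1 \<in> toeplitz m" and psd: "psd (2 * m) (four_block_mat x0 (mat_adjoint x1) x1 x0)"
  \<comment> \<open>The given block matrix has Toeplitz blocks and equal diagonal blocks, so the
    case of size two represents it by a measure, whose higher moments are the blocks sought.\<close>
  let ?x = "four_block_mat x0 (mat_adjoint x1) x1 x0"
  have adj: "mat_adjoint x1 \<in> toeplitz m" using x sys by (simp add: op_system_def)
  have car: "x0 \<in> carrier_mat m m" "x1 \<in> carrier_mat m m" "mat_adjoint x1 \<in> carrier_mat m m"
    using x adj by (auto simp: toeplitz_def)
  have block: "block m ?x 0 0 = x0" "block m ?x 0 1 = mat_adjoint x1" "block m ?x 1 0 = x1" "block m ?x 1 1 = x0"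
    using car by (auto intro!: eq_matI simp: block_def)
  have toep: "block m ?x i j \<in> toeplitz m" if "i < 2" "j < 2" for i j
  proof -
    have "i = 0 \<or> i = 1" "j = 0 \<or> j = 1" using that by auto
    thus ?thesis by (elim disjE) (simp_all only: block x adj)
  qed
  have "atomic 2 m ?x" by (rule psd_2_toeplitz_atomic[OF psd toep]) (assumption | simp only: block)+
  then obtain X :: "nat \<Rightarrow> complex mat" where "X 0 = block m ?x 0 0" "X 1 = block m ?x 1 0"
    "\<And>j. X j \<in> toeplitz m" "\<And>N. psd (N * m) (block_toeplitz N m X)"
    by (rule atomic_extension) (rule that)
  thus "\<exists>x :: nat \<Rightarrow> complex mat. x 0 = x0 \<and> x 1 = x1 \<and>
      (\<forall>j \<in> {2..<N}. x j \<in> toeplitz m) \<and> psd (N * m) (block_toeplitz N m x)"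
    unfolding block by (intro exI[of _ X]) simp
qed

end
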